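(* Let $|q|<1$, let $\rho_1,\rho_2$ be real with $|\rho_1|,|\rho_2|<1$, and let $y,z\in S(q)=[-2/\sqrt{1-q},2/\sqrt{1-q}]$. Then for every $n\ge1$ the function $$C_n(y,z|\rho_1,\rho_2,q)=\int_{S(q)}H_n(x|q)\,\phi(x|y,\rho_1,z,\rho_2,q)\,dx$$ is given by $$C_n(y,z|\rho_1,\rho_2,q)=\frac1{(\rho_1^2\rho_2^2)_n}\sum_{k=0}^{\lfloor n/2\rfloor}(-1)^kq^{\binom k2}\begin{bmatrix} n \\ 2k \end{bmatrix}_q\begin{bmatrix} 2k \\ k \end{bmatrix}_q[k]_q!\,\rho_1^{2k}\rho_2^{2k}(\rho_1^2)_k(\rho_2^2)_k\sum_{j=0}^{n-2k}\begin{bmatrix} n-2k \\ j \end{bmatrix}_q(\rho_1^2q^k)_j(\rho_2^2q^k)_{n-2k-j}\,\rho_1^{n-2k-j}\rho_2^{j}\,H_j(z|q)\,H_{n-2k-j}(y|q).$$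
   Context: Notation: $(\alpha)_n=(\alpha;q)_n=\prod_{i=0}^{n-1}(1-\alpha q^i)$, $(\alpha)_0=1$, $(\alpha)_\infty=\prod_{i\ge0}(1-\alpha q^i)$, with $0^0=1$; $[n]_q=1+q+\dots+q^{n-1}$, $[0]_q=0$, $[n]_q!=\prod_{i=1}^n[i]_q$, $[0]_q!=1$; $\begin{bmatrix} n \\ k \end{bmatrix}_q=\frac{[n]_q!}{[k]_q![n-k]_q!}$ for $0\le k\le n$ and $0$ otherwise. $q$-Hermite polynomials: $H_{-1}(x|q)=0$, $H_0(x|q)=1$, $H_{n+1}(x|q)=xH_n(x|q)-[n]_qH_{n-1}(x|q)$ for $n\ge0$. For $x\in S(q)$, $$f_N(x|q)=\frac{\sqrt{1-q}\,(q)_\infty}{2\pi\sqrt{4-(1-q)x^2}}\prod_{k=0}^\infty\big((1+q^k)^2-(1-q)x^2q^k\big)$$ (the $k=0$ factor is $4-(1-q)x^2$, so the value at the endpoints is understood as $0$). For $k\ge0$, $w_k(x,y|\rho,q)=(1-\rho^2q^{2k})^2-(1-q)\rho q^k(1+\rho^2q^{2k})xy+(1-q)\rho^2(x^2+y^2)q^{2k}$. The density $\phi$ (a rescaled normalized Askey--Wilson weight) is, for $x,y,z\in S(q)$, $$\phi(x|y,\rho_1,z,\rho_2,q)=f_N(x|q)\,\frac{(\rho_1^2)_\infty(\rho_2^2)_\infty}{(\rho_1^2\rho_2^2)_\infty}\prod_{k=0}^\infty\frac{w_k(y,z|\rho_1\rho_2,q)}{w_k(x,y|\rho_1,q)\,w_k(x,z|\rho_2,q)}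 .$$ *)

theory Defs
  imports "HOL-Analysis.Analysis"
begin

definition qpoch :: "real \<Rightarrow> real \<Rightarrow> nat \<Rightarrow> real" where
  "qpoch \<alpha> q n = (\<Prod>i<n. 1 - \<alpha> * q ^ i)"

definition qpoch_inf :: "real \<Rightarrow> real \<Rightarrow> real" where
  "qpoch_inf \<alpha> q = (\<Prod>i. 1 - \<alpha> * q ^ i)"

definition qnum :: "real \<Rightarrow> nat \<Rightarrow> real" where
  "qnum q n = (\<Sum>i<n. q ^ i)"

definition qfact :: "real \<Rightarrow> nat \<Rightarrow> real" where
  "qfact q n = (\<Prod>i=1..n. qnum q i)"

definition qbinom :: "real \<Rightarrow> nat \<Rightarrow> nat \<Rightarrow> real" where
  "qbinom q n k = (if k \<le> n then qfact q n / (qfact q k * qfact q (n - k)) else 0)"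

(* The case Suc 0 is the recurrence at n = 0 with H_(-1) = 0. *)
fun qHermite :: "real \<Rightarrow> nat \<Rightarrow> real \<Rightarrow> real" where
  "qHermite q 0 x = 1"
| "qHermite q (Suc 0) x = x"
| "qHermite q (Suc (Suc n)) x = x * qHermite q (Suc n) x - qnum q (Suc n) * qHermite q n x"

definition S :: "real \<Rightarrow> real set" where
  "S q = {- 2 / sqrt (1 - q) .. 2 / sqrt (1 - q)}"

(* At the endpoints of S q the denominator vanishes; division by zero then gives the
   intended value 0. *)
definition f_N :: "real \<Rightarrow> real \<Rightarrow> real" where
  "f_N q x = sqrt (1 - q) * qpoch_inf q q / (2 * pi * sqrt (4 - (1 - q) * x\<^sup>2)) *
     (\<Prod>k. (1 + q ^ k)\<^sup>2 - (1 - q) * x\<^sup>2 * q ^ k)"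

definition w :: "nat \<Rightarrow> real \<Rightarrow> real \<Rightarrow> real \<Rightarrow> real \<Rightarrow> real" where
  "w k x y \<rho> q = (1 - \<rho>\<^sup>2 * q ^ (2 * k))\<^sup>2
     - (1 - q) * \<rho> * q ^ k * (1 + \<rho>\<^sup>2 * q ^ (2 * k)) * x * y
     + (1 - q) * \<rho>\<^sup>2 * (x\<^sup>2 + y\<^sup>2) * q ^ (2 * k)"

definition phi :: "real \<Rightarrow> real \<Rightarrow> real \<Rightarrow> real \<Rightarrow> real \<Rightarrow> real \<Rightarrow> real" where
  "phi x y \<rho>1 z \<rho>2 q =
     f_N q x * (qpoch_inf (\<rho>1\<^sup>2) q * qpoch_inf (\<rho>2\<^sup>2) q / qpoch_inf (\<rho>1\<^sup>2 * \<rho>2\<^sup>2) q) *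
     (\<Prod>k. w k y z (\<rho>1 * \<rho>2) q / (w k x y \<rho>1 q * w k x z \<rho>2 q))"

definition C :: "nat \<Rightarrow> real \<Rightarrow> real \<Rightarrow> real \<Rightarrow> real \<Rightarrow> real \<Rightarrow> real" where
  "C n y z \<rho>1 \<rho>2 q = (LINT x:S q|lborel. qHermite q n x * phi x y \<rho>1 z \<rho>2 q)"

end

theory Submission
  imports Defs
begin

text \<open>By the Poisson--Mehler formula, \<open>phi\<close> is \<open>f_N\<close> times a quotient of Mehler kernels,
  \<open>P(x,y|\<rho>1) P(x,z|\<rho>2) / P(y,z|\<rho>1 \<rho>2)\<close>. Expanding both kernels in the numerator and using orthogonality and
  the linearization of \<open>H\<^sub>a H\<^sub>b\<close> turns the integral into a combination of the shifted kernels
  \<open>\<Sum>m. t\<^sup>m / [m]! H\<^sub>m\<^sub>+\<^sub>i(y) H\<^sub>m\<^sub>+\<^sub>j(z)\<close> with \<open>t = \<rho>1 \<rho>2\<close>. The three-term recurrence of \<open>H\<close> gives contiguous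
  relations between these, and hence a recurrence in \<open>n\<close> for the combination; the explicit double sum
  satisfies the same recurrence. The contiguous relations also give a functional equation under
  \<open>t \<mapsto> q t\<close> which proves the Poisson--Mehler formula by iteration. Orthogonality with respect to \<open>f_N\<close>
  is obtained by truncating its infinite product: the moments against the truncated product have a
  closed form, verified by induction on the number of factors.\<close>

section \<open>The polynomial side\<close>

text \<open>Each contiguous relation of the shifted kernels raises both indices at once, so a single
  raised value comes from a 2x2 system with determinant \<open>1 - t\<^sup>2 * q ^ (i + j)\<close>;
  these determinants multiply up to the denominator \<open>qpoch (t\<^sup>2) q n\<close> of the
  theorem. Summed over \<open>i + j = n\<close> with weights \<open>r ^ i * s ^ j\<close>, the
  kernels obey a recurrence of their own. The rule
  \<open>qnum q (i + j) = qnum q i + q ^ i * qnum q j\<close> puts \<open>q ^ i\<close> next to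
  \<open>r ^ i\<close>, which is the origin of the rescaled argument \<open>q * r\<close>. The
  relations are linear and fix every diagonal sum from the unshifted kernel, which therefore comes
  out as a factor and cancels the kernel that \<open>phi\<close> has in its denominator. For
  orthogonality it is enough to integrate a single q-Hermite polynomial, since linearization reduces
  products to that case. One more factor of the weight is a quadratic polynomial in
  \<open>cos \<theta>\<close>, so the truncated integrals satisfy a finite recurrence in the number
  of factors, and the limit can be read off the closed form.\<close>

lemma qnum_0 [simp]: "qnum q 0 = 0"
  by (simp add: qnum_def)

lemma qnum_Suc: "qnum q (Suc n) = qnum q n + q ^ n"
  by (simp add: qnum_def)

lemma qnum_1 [simp]: "qnum q (Suc 0) = 1"
  by (simp add: qnum_def)

lemma qnum_add: "qnum q (m + n) = qnum q m + q ^ m * qnum q n"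
  by (induction n) (simp_all add: qnum_Suc algebra_simps power_add)

lemma one_minus_times_qnum: "(1 - q) * qnum q n = 1 - q ^ n"
proof (induction n)
  case (Suc n)
  then show ?case by (simp add: qnum_Suc distrib_left) (simp add: algebra_simps)
qed simp

text \<open>For negative \<open>q\<close> the defining sum has terms of both signs, so positivity is
  taken from \<open>one_minus_times_qnum\<close> instead.\<close>

lemma qnum_Suc_pos:
  assumes "\<bar>q\<bar> < 1" shows "qnum q (Suc n) > 0"
proof -
  have "\<bar>q\<bar> ^ Suc n < 1"
    using assms by (simp only: power_less_one_iff abs_ge_zero) simp
  then have "q ^ Suc n < 1"
    by (metis abs_le_D1 le_less_trans order_refl power_abs)
  then have "(1 - q) * qnum q (Suc n) > 0"
    by (simp only: one_minus_times_qnum)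
  then show ?thesis
    using assms by (auto simp: zero_less_mult_iff)
qed

lemma qfact_0 [simp]: "qfact q 0 = 1"
  by (simp add: qfact_def)

lemma qfact_Suc: "qfact q (Suc n) = qnum q (Suc n) * qfact q n"
  by (simp add: qfact_def)

lemma qfact_pos: "\<bar>q\<bar> < 1 \<Longrightarrow> qfact q n > 0"
  by (induction n) (simp_all add: qfact_Suc qnum_Suc_pos)

lemma qfact_neq_0: "\<bar>q\<bar> < 1 \<Longrightarrow> qfact q n \<noteq> 0"
  using qfact_pos[of q n] by simp

lemma qnum_Suc_neq_0: "\<bar>q\<bar> < 1 \<Longrightarrow> qnum q (Suc n) \<noteq> 0"
  using qnum_Suc_pos[of q n] by simp

lemma mult_qHermite:
  "x * qHermite q n x = qHermite q (Suc n) x + qnum q n * qHermite q (n - 1) x"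
  by (cases n) simp_all

lemma Suc_choose_2: "Suc n choose 2 = n + (n choose 2)"
  by (simp add: numeral_2_eq_2)

text \<open>The index shift \<open>k\<close> encodes the convention that polynomials of negative degree vanish.\<close>

definition shifted_hat :: "real \<Rightarrow> real \<Rightarrow> nat \<Rightarrow> nat \<Rightarrow> real" where
  "shifted_hat q x m k = (if k \<le> m then qHermite q (m - k) x / qfact q (m - k) else 0)"

lemma shifted_hat_Suc_Suc: "shifted_hat q x (Suc m) (Suc k) = shifted_hat q x m k"
  by (simp add: shifted_hat_def)

lemma shifted_hat_eq_0: "m < k \<Longrightarrow> shifted_hat q x m k = 0"
  by (simp add: shifted_hat_def)

text \<open>The three-term recurrence divided by the q-factorial, which normalizes the lowering
  coefficient to 1. At \<open>k = Suc m\<close> the left side is 0 while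
  \<open>shifted_hat q x (Suc m) k\<close> is 1; its coefficient \<open>qnum q 0\<close> saves the
  identity.\<close>

lemma mult_shifted_hat:
  assumes "\<bar>q\<bar> < 1"
  shows "x * shifted_hat q x m k = qnum q (Suc m - k) * shifted_hat q x (Suc m) k + shifted_hat q x m (Suc k)"
proof (cases "k \<le> m")
  case True
  then obtain d where d: "m = k + d" using le_Suc_ex by blast
  have "x * qHermite q d x / qfact q d = qHermite q (Suc d) x / qfact q d
        + qnum q d * qHermite q (d - 1) x / qfact q d"
    by (simp add: mult_qHermite add_divide_distrib)
  moreover have "qHermite q (Suc d) x / qfact q d
      = qnum q (Suc d) * (qHermite q (Suc d) x / qfact q (Suc d))"
    using qfact_neq_0[OF assms] qnum_Suc_neq_0[OF assms] by (simp add: qfact_Suc)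
  moreover have "qnum q d * qHermite q (d - 1) x / qfact q d
      = (if d = 0 then 0 else qHermite q (d - 1) x / qfact q (d - 1))"
    using qfact_neq_0[OF assms] qnum_Suc_neq_0[OF assms] by (cases d) (simp_all add: qfact_Suc)
  ultimately show ?thesis
    by (auto simp add: shifted_hat_def d Suc_diff_le)
next
  case False
  then show ?thesis
    by (auto simp add: shifted_hat_def not_le less_Suc_eq)
qed

text \<open>Coefficients of one of Euler's two q-exponentials; their sum over \<open>k\<close> is
  the reciprocal of the series with terms \<open>t ^ m / qfact q m\<close> that weights the Mehler
  kernel.\<close>

definition mcoeff :: "real \<Rightarrow> real \<Rightarrow> nat \<Rightarrow> real" where
  "mcoeff q t k = (-1) ^ k * q ^ (k choose 2) * t ^ k / qfact q k"

lemma qnum_mult_mcoeff: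
  assumes "\<bar>q\<bar> < 1"
  shows "qnum q (Suc k) * mcoeff q t (Suc k) = - t * q ^ k * mcoeff q t k"
  using qfact_neq_0[OF assms] qnum_Suc_neq_0[OF assms]
  by (simp add: mcoeff_def qfact_Suc Suc_choose_2 power_add del: binomial_Suc_Suc)

text \<open>A finite counterpart of the shifted kernels: reciprocal coefficients, and indices
  lowered instead of raised. Terms with \<open>k\<close> above \<open>i\<close> or \<open>j\<close>
  vanish, so the upper limit is a matter of convenience.\<close>

definition mehler_poly :: "real \<Rightarrow> real \<Rightarrow> real \<Rightarrow> real \<Rightarrow> nat \<Rightarrow> nat \<Rightarrow> real" where
  "mehler_poly q t y z i j = (\<Sum>k\<le>i. mcoeff q t k * shifted_hat q y i k * shifted_hat q z j k)"

text \<open>Truncated subtraction would return \<open>f 0 j\<close> at index -1, where the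
  contiguous relations need 0.\<close>

definition low1 :: "(nat \<Rightarrow> nat \<Rightarrow> real) \<Rightarrow> nat \<Rightarrow> nat \<Rightarrow> real" where
  "low1 f i j = (case i of 0 \<Rightarrow> 0 | Suc i' \<Rightarrow> f i' j)"

definition low2 :: "(nat \<Rightarrow> nat \<Rightarrow> real) \<Rightarrow> nat \<Rightarrow> nat \<Rightarrow> real" where
  "low2 f i j = (case j of 0 \<Rightarrow> 0 | Suc j' \<Rightarrow> f i j')"

lemma low_simps [simp]:
  "low1 f 0 j = 0" "low1 f (Suc i) j = f i j"
  "low2 f i 0 = 0" "low2 f i (Suc j) = f i j"
  by (simp_all add: low1_def low2_def)

lemma mehler_poly_extend:
  assumes "i \<le> K \<or> j \<le> K"
  shows "mehler_poly q t y z i j = (\<Sum>k\<le>K. mcoeff q t k * shifted_hat q y i k * shifted_hat q z j k)"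
  unfolding mehler_poly_def
proof (cases "i \<le> K")
  case True
  then show "(\<Sum>k\<le>i. mcoeff q t k * shifted_hat q y i k * shifted_hat q z j k)
    = (\<Sum>k\<le>K. mcoeff q t k * shifted_hat q y i k * shifted_hat q z j k)"
    by (intro sum.mono_neutral_left) (auto simp: shifted_hat_eq_0)
next
  case False
  with assms show "(\<Sum>k\<le>i. mcoeff q t k * shifted_hat q y i k * shifted_hat q z j k)
    = (\<Sum>k\<le>K. mcoeff q t k * shifted_hat q y i k * shifted_hat q z j k)"
    by (intro sum.mono_neutral_right) (auto simp: shifted_hat_eq_0)
qed

lemma mehler_poly_commute: "mehler_poly q t y z i j = mehler_poly q t z y j i"
  by (subst mehler_poly_extend[of i "i + j" j]) (auto simp: mehler_poly_extend[of j "i + j" i] mult_ac)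

lemma low1_mehler_poly: "low1 (mehler_poly q t y z) i j = (\<Sum>k\<le>i. mcoeff q t k * shifted_hat q y i (Suc k) * shifted_hat q z j k)"
proof (cases i)
  case (Suc i')
  show ?thesis
    by (simp add: Suc shifted_hat_Suc_Suc mehler_poly_extend[of i' "Suc i'"] del: sum.atMost_Suc)
qed (simp add: shifted_hat_eq_0)

lemma low2_mehler_poly: "low2 (mehler_poly q t y z) i j = (\<Sum>k\<le>i. mcoeff q t k * shifted_hat q y i k * shifted_hat q z j (Suc k))"
  by (cases j) (simp_all add: shifted_hat_Suc_Suc mehler_poly_def shifted_hat_eq_0)

text \<open>The recurrence of \<open>shifted_hat\<close> produces \<open>qnum q (Suc i - k)\<close>,
  which is \<open>qnum q (Suc i)\<close> minus a multiple of \<open>qnum q k\<close>. The latter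
  shifts \<open>k\<close> through \<open>qnum_mult_mcoeff\<close>; the powers
  \<open>q ^ (i - k)\<close> and \<open>q ^ k\<close> then join to \<open>q ^ i\<close>, free of
  \<open>k\<close>.\<close>

lemma mehler_poly_rec1:
  assumes q: "\<bar>q\<bar> < 1"
  shows "y * mehler_poly q t y z i j = qnum q (Suc i) * mehler_poly q t y z (Suc i) j
    + t * q ^ i * low2 (mehler_poly q t y z) i j + low1 (mehler_poly q t y z) i j"
proof -
  let ?a = "mcoeff q t" and ?u = "shifted_hat q y" and ?v = "shifted_hat q z"
  have term1: "qnum q (Suc i - k) * ?u (Suc i) k =
      qnum q (Suc i) * ?u (Suc i) k - q ^ (Suc i - k) * qnum q k * ?u (Suc i) k" for k
  proof (cases "k \<le> Suc i")
    case True
    then obtain d where "Suc i = d + k" by (metis add.commute le_Suc_ex)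
    then show ?thesis by (simp add: qnum_add algebra_simps)
  qed (simp add: shifted_hat_eq_0)
  have "y * mehler_poly q t y z i j = (\<Sum>k\<le>Suc i. ?a k * (y * ?u i k) * ?v j k)"
    by (simp add: mehler_poly_extend[of i "Suc i"] sum_distrib_left mult_ac del: sum.atMost_Suc)
  also have "\<dots> = (\<Sum>k\<le>Suc i. qnum q (Suc i) * (?a k * ?u (Suc i) k * ?v j k))
      - (\<Sum>k\<le>Suc i. q ^ (Suc i - k) * qnum q k * ?a k * ?u (Suc i) k * ?v j k)
      + (\<Sum>k\<le>Suc i. ?a k * ?u i (Suc k) * ?v j k)"
    unfolding mult_shifted_hat[OF q] term1 sum.distrib[symmetric] sum_subtractf[symmetric]
    by (intro sum.cong refl) (simp add: algebra_simps)
  also have "(\<Sum>k\<le>Suc i. qnum q (Suc i) * (?a k * ?u (Suc i) k * ?v j k))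
      = qnum q (Suc i) * mehler_poly q t y z (Suc i) j"
    by (simp only: mehler_poly_def sum_distrib_left)
  also have "(\<Sum>k\<le>Suc i. ?a k * ?u i (Suc k) * ?v j k) = low1 (mehler_poly q t y z) i j"
    by (simp add: low1_mehler_poly shifted_hat_eq_0)
  also have "(\<Sum>k\<le>Suc i. q ^ (Suc i - k) * qnum q k * ?a k * ?u (Suc i) k * ?v j k)
      = (\<Sum>k\<le>i. q ^ (i - k) * (qnum q (Suc k) * ?a (Suc k)) * ?u i k * ?v j (Suc k))"
    by (subst sum.atMost_Suc_shift) (simp add: shifted_hat_Suc_Suc mult_ac)
  also have "\<dots> = (\<Sum>k\<le>i. - (t * q ^ i) * (?a k * ?u i k * ?v j (Suc k)))"
  proof (intro sum.cong refl)
    fix k assume "k \<in> {..i}"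
    then have "q ^ i = q ^ (i - k) * q ^ k" by (simp add: power_add[symmetric])
    then show "q ^ (i - k) * (qnum q (Suc k) * ?a (Suc k)) * ?u i k * ?v j (Suc k)
      = - (t * q ^ i) * (?a k * ?u i k * ?v j (Suc k))"
      by (simp add: qnum_mult_mcoeff[OF q])
  qed
  also have "\<dots> = - (t * q ^ i * low2 (mehler_poly q t y z) i j)"
    by (simp add: low2_mehler_poly sum_distrib_left sum_negf)
  finally show ?thesis by simp
qed

lemma low_mehler_poly_commute: "low1 (mehler_poly q t y z) i j = low2 (mehler_poly q t z y) j i"
  by (cases i) (simp_all add: mehler_poly_commute[of q t y z])

lemma mehler_poly_rec2:
  assumes q: "\<bar>q\<bar> < 1"
  shows "z * mehler_poly q t y z i j = qnum q (Suc j) * mehler_poly q t y z i (Suc j)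
    + t * q ^ j * low1 (mehler_poly q t y z) i j + low2 (mehler_poly q t y z) i j"
  using mehler_poly_rec1[OF q, of z t y j i]
  by (simp add: mehler_poly_commute[of q t y z] low_mehler_poly_commute[of q t y z] low_mehler_poly_commute[of q t z y])

text \<open>This is \<open>r\<^sup>m (t s / r; q)\<^sub>m\<close> without the division. In the theorem \<open>t = \<rho>1 \<rho>2\<close>, \<open>r = \<rho>1\<close>,
  \<open>s = \<rho>2\<close>, but the recurrence in \<open>n\<close> rescales \<open>r\<close> while \<open>t\<close> stays fixed, so the three
  have to be decoupled.\<close>

definition tpoch :: "real \<Rightarrow> real \<Rightarrow> nat \<Rightarrow> real \<Rightarrow> real \<Rightarrow> real" where
  "tpoch q t m r s = (\<Prod>l<m. r - t * s * q ^ l)"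

lemma tpoch_0 [simp]: "tpoch q t 0 r s = 1"
  by (simp add: tpoch_def)

lemma tpoch_Suc: "tpoch q t (Suc m) r s = tpoch q t m r s * (r - t * s * q ^ m)"
  by (simp add: tpoch_def)

lemma tpoch_Suc_scale2: "tpoch q t (Suc m) r s = (r - t * s) * tpoch q t m r (q * s)"
  unfolding tpoch_def prod.lessThan_Suc_shift by (simp add: mult_ac)

text \<open>With \<open>r\<close> scaled by \<open>q\<close>, factor number \<open>l + 1\<close> is
  \<open>q\<close> times the unscaled factor number \<open>l\<close>; only the factor with index 0
  is left over.\<close>

lemma tpoch_Suc_scale1: "tpoch q t (Suc m) (q * r) s = q ^ m * (q * r - t * s) * tpoch q t m r s"
proof (induction m)
  case (Suc m)
  then show ?case
    by (subst tpoch_Suc, simp only: Suc.IH tpoch_Suc[of q t m r s]) (simp add: algebra_simps)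
qed (simp add: tpoch_Suc)

text \<open>At \<open>t = r * s\<close> this becomes, up to \<open>qfact q n\<close>, the double sum
  of the theorem with the order of summation exchanged; see
  \<open>moment_poly_explicit\<close>.\<close>

definition moment_poly :: "real \<Rightarrow> real \<Rightarrow> real \<Rightarrow> real \<Rightarrow> nat \<Rightarrow> real \<Rightarrow> real \<Rightarrow> real" where
  "moment_poly q t y z n r s = (\<Sum>i\<le>n. tpoch q t i r s * tpoch q t (n - i) s r * mehler_poly q t y z i (n - i))"

lemma sum_low1: "(\<Sum>i\<le>n. g i * low1 f i (n - i)) =
  (case n of 0 \<Rightarrow> 0 | Suc m \<Rightarrow> \<Sum>i\<le>m. g (Suc i) * f i (m - i))"
proof (cases n)
  case (Suc m)
  show ?thesis unfolding Suc sum.atMost_Suc_shift by simp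
qed simp

lemma sum_low2: "(\<Sum>i\<le>n. g i * low2 f i (n - i)) =
  (case n of 0 \<Rightarrow> 0 | Suc m \<Rightarrow> \<Sum>i\<le>m. g i * f i (m - i))"
proof (cases n)
  case (Suc m)
  then show ?thesis by (simp add: Suc_diff_le)
qed simp

text \<open>The shape is dictated by \<open>kernel_poly_rec\<close>: the factor
  \<open>1 - t\<^sup>2 * q ^ m\<close> inside \<open>Rp\<close> is the quotient of consecutive
  values of \<open>qpoch (t\<^sup>2) q\<close>, by which the two recurrences differ.\<close>

lemma moment_poly_rec:
  fixes q t y z r s :: real
  assumes q: "\<bar>q\<bar> < 1"
  defines "Rp \<equiv> \<lambda>n r s. case n of 0 \<Rightarrow> 0 | Suc m \<Rightarrow> (1 - t\<^sup>2 * q ^ m) * moment_poly q t y z m r s"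
  shows "qnum q (Suc n) * moment_poly q t y z (Suc n) r s =
     (r - t * s * q ^ n) * (y * moment_poly q t y z n r s - r * Rp n r s)
     + (s - t * r) * (z * moment_poly q t y z n (q * r) s - s * Rp n (q * r) s)"
proof -
  let ?X = "mehler_poly q t y z"
  let ?A = "\<lambda>i. tpoch q t i r s" and ?B = "\<lambda>j. tpoch q t j s r"
  let ?A' = "\<lambda>i. tpoch q t i (q * r) s" and ?B' = "\<lambda>j. tpoch q t j s (q * r)"
  have B': "(s - t * r) * ?B' j = ?B (Suc j)" for j
    by (simp add: tpoch_Suc_scale2)
  \<comment> \<open>Each term of diagonal \<open>Suc n\<close> is split in two: \<open>F\<close>
    carries \<open>qnum q i * ?X i j\<close> and is reduced by the relation for \<open>y\<close>,
    \<open>G\<close> carries \<open>qnum q j * ?X i j\<close> and is reduced by the one for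
    \<open>z\<close>. The outer coefficients depend on \<open>n\<close> only and can leave the
    sums.\<close>
  define F where "F i j = (case i of 0 \<Rightarrow> 0
    | Suc i' \<Rightarrow> (r - t * s * q ^ n) * qnum q i * ?A i' * ?B j * ?X i j)" for i j
  define G where "G i j = (case j of 0 \<Rightarrow> 0
    | Suc j' \<Rightarrow> (s - t * r) * qnum q j * ?A' i * ?B' j' * ?X i j)" for i j
  have split: "qnum q (Suc n) * (?A i * ?B j * ?X i j) = F i j + G i j" if "i + j = Suc n" for i j
  proof -
    have G: "G i j = qnum q j * ?A' i * ?B j * ?X i j"
      by (cases j) (simp_all add: G_def B'[symmetric])
    show ?thesis
    proof (cases i)
      case 0
      then show ?thesis using that unfolding G by (simp add: F_def)
    next
      case (Suc i')
      have n: "n = i' + j" using that Suc by simp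
      have 1: "qnum q (Suc n) = qnum q (Suc i') + q ^ Suc i' * qnum q j"
        using qnum_add[of q "Suc i'" j] by (simp add: n)
      have 2: "qnum q (Suc n) = q ^ j * qnum q (Suc i') + qnum q j"
        using qnum_add[of q j "Suc i'"] by (simp add: n add_ac)
      \<comment> \<open>The two ways of splitting \<open>qnum q (Suc n)\<close> are both used: the
        first for the coefficient of \<open>r\<close>, the second for that of
        \<open>t * s\<close>.\<close>
      have "qnum q (Suc n) * (r - t * s * q ^ i')
          = (r - t * s * q ^ n) * qnum q (Suc i') + qnum q j * (q ^ i' * (q * r - t * s))"
      proof -
        have "qnum q (Suc n) * (r - t * s * q ^ i')
          = r * qnum q (Suc n) - t * s * q ^ i' * qnum q (Suc n)" by (simp add: algebra_simps)
        also have "\<dots> = r * (qnum q (Suc i') + q ^ Suc i' * qnum q j)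
            - t * s * q ^ i' * (q ^ j * qnum q (Suc i') + qnum q j)"
          by (simp only: 1[symmetric] 2[symmetric])
        finally show ?thesis by (simp add: n power_add algebra_simps)
      qed
      moreover have "qnum q (Suc n) * (?A i * ?B j * ?X i j)
          = qnum q (Suc n) * (r - t * s * q ^ i') * (?A i' * ?B j * ?X i j)"
        by (simp add: Suc tpoch_Suc mult_ac)
      moreover have "F i j + G i j
          = ((r - t * s * q ^ n) * qnum q (Suc i') + qnum q j * (q ^ i' * (q * r - t * s)))
            * (?A i' * ?B j * ?X i j)"
        unfolding G by (simp add: F_def Suc tpoch_Suc_scale1) (simp add: algebra_simps)
      ultimately show ?thesis by simp
    qed
  qed
  have "qnum q (Suc n) * moment_poly q t y z (Suc n) r s =
     (\<Sum>i\<le>Suc n. F i (Suc n - i)) + (\<Sum>i\<le>Suc n. G i (Suc n - i))"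
    unfolding moment_poly_def sum_distrib_left sum.distrib[symmetric]
    by (intro sum.cong refl split) auto
  also have "(\<Sum>i\<le>Suc n. F i (Suc n - i)) = (\<Sum>i\<le>n. F (Suc i) (n - i))"
    by (subst sum.atMost_Suc_shift) (simp add: F_def)
  also have "\<dots> = (r - t * s * q ^ n) * (\<Sum>i\<le>n. ?A i * ?B (n - i) * (qnum q (Suc i) * ?X (Suc i) (n - i)))"
    by (simp add: F_def sum_distrib_left mult_ac)
  also have "(\<Sum>i\<le>n. ?A i * ?B (n - i) * (qnum q (Suc i) * ?X (Suc i) (n - i)))
    = y * moment_poly q t y z n r s - (\<Sum>i\<le>n. t * q ^ i * ?A i * ?B (n - i) * low2 ?X i (n - i))
      - (\<Sum>i\<le>n. ?A i * ?B (n - i) * low1 ?X i (n - i))"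
    unfolding moment_poly_def sum_distrib_left sum_subtractf[symmetric]
  proof (intro sum.cong refl)
    fix i
    show "?A i * ?B (n - i) * (qnum q (Suc i) * ?X (Suc i) (n - i)) =
         y * (?A i * ?B (n - i) * ?X i (n - i)) -
         t * q ^ i * ?A i * ?B (n - i) * low2 ?X i (n - i) -
         ?A i * ?B (n - i) * low1 ?X i (n - i)"
      using arg_cong[OF mehler_poly_rec1[OF q, of y t z i "n - i"], of "\<lambda>u. ?A i * ?B (n - i) * u"]
      by (simp add: algebra_simps)
  qed
  also have "y * moment_poly q t y z n r s - (\<Sum>i\<le>n. t * q ^ i * ?A i * ?B (n - i) * low2 ?X i (n - i))
      - (\<Sum>i\<le>n. ?A i * ?B (n - i) * low1 ?X i (n - i)) = y * moment_poly q t y z n r s - r * Rp n r s"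
  proof (cases n)
    case (Suc m)
    \<comment> \<open>After reindexing, the two lowering terms share the factor
      \<open>?A i * ?B d * ?X i d\<close> with \<open>d = m - i\<close>, and the remainder
      \<open>t * q ^ i * (s - t * r * q ^ d) + (r - t * s * q ^ i)\<close> collapses to
      \<open>r * (1 - t\<^sup>2 * q ^ m)\<close>.\<close>
    have "(\<Sum>i\<le>n. t * q ^ i * ?A i * ?B (n - i) * low2 ?X i (n - i))
      + (\<Sum>i\<le>n. ?A i * ?B (n - i) * low1 ?X i (n - i)) = r * Rp n r s"
      unfolding sum_low1 sum_low2 Rp_def moment_poly_def Suc nat.case sum_distrib_left sum.distrib[symmetric]
    proof (intro sum.cong refl)
      fix i assume "i \<in> {..m}"
      then have "m = i + (m - i)" "Suc m - i = Suc (m - i)" by auto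
      then obtain d where d: "m = i + d" "m - i = d" "Suc m - i = Suc d" by metis
      show "t * q ^ i * ?A i * ?B (Suc m - i) * ?X i (m - i) +
         ?A (Suc i) * ?B (Suc m - Suc i) * ?X i (m - i) =
         r * ((1 - t\<^sup>2 * q ^ m) * (?A i * ?B (m - i) * ?X i (m - i)))"
        unfolding diff_Suc_Suc d(2,3) unfolding d(1)
        by (simp add: tpoch_Suc power_add power2_eq_square algebra_simps)
    qed
    then show ?thesis by simp
  qed (simp add: Rp_def)
  also have "(\<Sum>i\<le>Suc n. G i (Suc n - i)) = (\<Sum>i\<le>n. G i (Suc (n - i)))"
    by (simp add: Suc_diff_le) (simp add: G_def)
  also have "\<dots> = (s - t * r) * (\<Sum>i\<le>n. ?A' i * ?B' (n - i) * (qnum q (Suc (n - i)) * ?X i (Suc (n - i))))"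
    by (simp add: G_def sum_distrib_left mult_ac)
  also have "(\<Sum>i\<le>n. ?A' i * ?B' (n - i) * (qnum q (Suc (n - i)) * ?X i (Suc (n - i))))
    = z * moment_poly q t y z n (q * r) s - (\<Sum>i\<le>n. t * q ^ (n - i) * ?A' i * ?B' (n - i) * low1 ?X i (n - i))
      - (\<Sum>i\<le>n. ?A' i * ?B' (n - i) * low2 ?X i (n - i))"
    unfolding moment_poly_def sum_distrib_left sum_subtractf[symmetric]
  proof (intro sum.cong refl)
    fix i
    show "?A' i * ?B' (n - i) * (qnum q (Suc (n - i)) * ?X i (Suc (n - i))) =
         z * (?A' i * ?B' (n - i) * ?X i (n - i)) -
         t * q ^ (n - i) * ?A' i * ?B' (n - i) * low1 ?X i (n - i) -
         ?A' i * ?B' (n - i) * low2 ?X i (n - i)"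
      using arg_cong[OF mehler_poly_rec2[OF q, of z t y i "n - i"], of "\<lambda>u. ?A' i * ?B' (n - i) * u"]
      by (simp add: algebra_simps)
  qed
  also have "z * moment_poly q t y z n (q * r) s - (\<Sum>i\<le>n. t * q ^ (n - i) * ?A' i * ?B' (n - i) * low1 ?X i (n - i))
      - (\<Sum>i\<le>n. ?A' i * ?B' (n - i) * low2 ?X i (n - i)) = z * moment_poly q t y z n (q * r) s - s * Rp n (q * r) s"
  proof (cases n)
    case (Suc m)
    have "(\<Sum>i\<le>n. t * q ^ (n - i) * ?A' i * ?B' (n - i) * low1 ?X i (n - i))
      + (\<Sum>i\<le>n. ?A' i * ?B' (n - i) * low2 ?X i (n - i)) = s * Rp n (q * r) s"
      unfolding sum_low1 sum_low2 Rp_def moment_poly_def Suc nat.case sum_distrib_left sum.distrib[symmetric]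
    proof (intro sum.cong refl)
      fix i assume "i \<in> {..m}"
      then have "m = i + (m - i)" "Suc m - i = Suc (m - i)" by auto
      then obtain d where d: "m = i + d" "m - i = d" "Suc m - i = Suc d" by metis
      show "t * q ^ (Suc m - Suc i) * ?A' (Suc i) * ?B' (Suc m - Suc i) * ?X i (m - i) +
         ?A' i * ?B' (Suc m - i) * ?X i (m - i) =
         s * ((1 - t\<^sup>2 * q ^ m) * (?A' i * ?B' (m - i) * ?X i (m - i)))"
        unfolding diff_Suc_Suc d(2,3) unfolding d(1)
        by (simp add: tpoch_Suc power_add power2_eq_square algebra_simps)
    qed
    then show ?thesis by simp
  qed (simp add: Rp_def)
  finally show ?thesis .
qed

section \<open>Diagonal sums of a solution of the contiguous relations\<close>

definition kernel_poly :: "(nat \<Rightarrow> nat \<Rightarrow> real) \<Rightarrow> nat \<Rightarrow> real \<Rightarrow> real \<Rightarrow> real" where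
  "kernel_poly G n r s = (\<Sum>i\<le>n. r ^ i * s ^ (n - i) * G i (n - i))"

text \<open>\<open>e1\<close> and \<open>e2\<close> are linear equations for the two raised values.
  Weighted with \<open>r - t * s * q ^ n\<close> and \<open>(s - t * r) * q ^ i\<close>, they add up
  so that both raised values acquire the common factor \<open>1 - t\<^sup>2 * q ^ n\<close>.\<close>

lemma kernel_poly_rec:
  fixes q t y z r s :: real
  assumes e1: "\<And>i j. y * G i j = qnum q (Suc i) * G (Suc i) j
      + t * q ^ i * (qnum q (Suc j) * G i (Suc j)) + low1 G i j"
    and e2: "\<And>i j. z * G i j = qnum q (Suc j) * G i (Suc j)
      + t * q ^ j * (qnum q (Suc i) * G (Suc i) j) + low2 G i j"
  defines "cp \<equiv> \<lambda>n r s. case n of 0 \<Rightarrow> 0 | Suc m \<Rightarrow> kernel_poly G m r s"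
  shows "(1 - t\<^sup>2 * q ^ n) * qnum q (Suc n) * kernel_poly G (Suc n) r s =
     (r - t * s * q ^ n) * (y * kernel_poly G n r s - r * cp n r s)
     + (s - t * r) * (z * kernel_poly G n (q * r) s - s * cp n (q * r) s)"
proof -
  have split: "qnum q (Suc n) * (r ^ i * s ^ j * G i j) =
      r ^ i * s ^ j * (qnum q i * G i j) + (q * r) ^ i * s ^ j * (qnum q j * G i j)"
    if "i + j = Suc n" for i j
    using that qnum_add[of q i j] by (simp add: algebra_simps)
  have "qnum q (Suc n) * kernel_poly G (Suc n) r s =
     (\<Sum>i\<le>Suc n. r ^ i * s ^ (Suc n - i) * (qnum q i * G i (Suc n - i)))
     + (\<Sum>i\<le>Suc n. (q * r) ^ i * s ^ (Suc n - i) * (qnum q (Suc n - i) * G i (Suc n - i)))"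
    unfolding kernel_poly_def sum_distrib_left sum.distrib[symmetric]
    by (intro sum.cong refl split) auto
  also have "(\<Sum>i\<le>Suc n. r ^ i * s ^ (Suc n - i) * (qnum q i * G i (Suc n - i)))
     = (\<Sum>i\<le>n. r ^ Suc i * s ^ (n - i) * (qnum q (Suc i) * G (Suc i) (n - i)))"
    by (subst sum.atMost_Suc_shift) simp
  also have "(\<Sum>i\<le>Suc n. (q * r) ^ i * s ^ (Suc n - i) * (qnum q (Suc n - i) * G i (Suc n - i)))
     = (\<Sum>i\<le>n. (q * r) ^ i * s ^ Suc (n - i) * (qnum q (Suc (n - i)) * G i (Suc (n - i))))"
    by (simp add: Suc_diff_le)
  finally have "(1 - t\<^sup>2 * q ^ n) * (qnum q (Suc n) * kernel_poly G (Suc n) r s) =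
    (\<Sum>i\<le>n. (1 - t\<^sup>2 * q ^ n) *
       (r ^ Suc i * s ^ (n - i) * (qnum q (Suc i) * G (Suc i) (n - i))
        + (q * r) ^ i * s ^ Suc (n - i) * (qnum q (Suc (n - i)) * G i (Suc (n - i)))))"
    by (simp only: sum.distrib sum_distrib_left distrib_left)
  also have "\<dots> = (\<Sum>i\<le>n. (r - t * s * q ^ n) * (y * (r ^ i * s ^ (n - i) * G i (n - i))
        - r ^ i * s ^ (n - i) * low1 G i (n - i))
      + (s - t * r) * (z * ((q * r) ^ i * s ^ (n - i) * G i (n - i))
        - (q * r) ^ i * s ^ (n - i) * low2 G i (n - i)))"
  proof (intro sum.cong refl)
    fix i assume i: "i \<in> {..n}"
    define j where "j = n - i"
    have n: "n = i + j" using i by (simp add: j_def)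
    define U V L1 L2 E where defs: "U = qnum q (Suc i) * G (Suc i) j"
      "V = qnum q (Suc j) * G i (Suc j)" "L1 = low1 G i j" "L2 = low2 G i j" "E = G i j"
    have 1: "y * E = U + t * q ^ i * V + L1" and 2: "z * E = V + t * q ^ j * U + L2"
      unfolding defs by (rule e1, rule e2)
    have "(1 - t\<^sup>2 * q ^ n) * (r ^ Suc i * s ^ j * U + (q * r) ^ i * s ^ Suc j * V)
       = (r - t * s * q ^ n) * (r ^ i * s ^ j * (y * E) - r ^ i * s ^ j * L1)
       + (s - t * r) * ((q * r) ^ i * s ^ j * (z * E) - (q * r) ^ i * s ^ j * L2)"
      unfolding 1 2 n by (simp add: power_add power_mult_distrib power2_eq_square algebra_simps)
    then show "(1 - t\<^sup>2 * q ^ n) *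
       (r ^ Suc i * s ^ (n - i) * (qnum q (Suc i) * G (Suc i) (n - i))
        + (q * r) ^ i * s ^ Suc (n - i) * (qnum q (Suc (n - i)) * G i (Suc (n - i))))
      = (r - t * s * q ^ n) * (y * (r ^ i * s ^ (n - i) * G i (n - i))
        - r ^ i * s ^ (n - i) * low1 G i (n - i))
      + (s - t * r) * (z * ((q * r) ^ i * s ^ (n - i) * G i (n - i))
        - (q * r) ^ i * s ^ (n - i) * low2 G i (n - i))"
      unfolding j_def[symmetric] defs by (simp only: mult_ac)
  qed
  also have "\<dots> = (r - t * s * q ^ n) * (y * kernel_poly G n r s
        - (\<Sum>i\<le>n. r ^ i * s ^ (n - i) * low1 G i (n - i)))
      + (s - t * r) * (z * kernel_poly G n (q * r) s
        - (\<Sum>i\<le>n. (q * r) ^ i * s ^ (n - i) * low2 G i (n - i)))"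
    unfolding kernel_poly_def sum.distrib sum_distrib_left[symmetric] sum_subtractf by simp
  also have "(\<Sum>i\<le>n. r ^ i * s ^ (n - i) * low1 G i (n - i)) = r * cp n r s"
    unfolding sum_low1 cp_def kernel_poly_def
    by (auto split: nat.split simp: sum_distrib_left mult_ac)
  also have "(\<Sum>i\<le>n. (q * r) ^ i * s ^ (n - i) * low2 G i (n - i)) = s * cp n (q * r) s"
    unfolding sum_low2 cp_def kernel_poly_def
    by (auto split: nat.split simp: sum_distrib_left mult_ac Suc_diff_le intro!: sum.cong)
  finally show ?thesis by (simp only: mult_ac)
qed

lemma qpoch_0 [simp]: "qpoch a q 0 = 1"
  by (simp add: qpoch_def)

lemma qpoch_Suc: "qpoch a q (Suc n) = qpoch a q n * (1 - a * q ^ n)"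
  by (simp add: qpoch_def)

lemma moment_poly_0 [simp]: "moment_poly q t y z 0 r s = 1"
  by (simp add: moment_poly_def mehler_poly_def mcoeff_def shifted_hat_def numeral_2_eq_2)

text \<open>Both sides have the same initial value and, once \<open>qpoch (t\<^sup>2) q n\<close>
  absorbs the determinants, the same recurrence. The induction keeps \<open>r\<close> arbitrary
  because the recurrence also evaluates at \<open>q * r\<close>.\<close>

lemma kernel_poly_eq_moment_poly:
  assumes q: "\<bar>q\<bar> < 1"
    and e1: "\<And>i j. y * G i j = qnum q (Suc i) * G (Suc i) j
      + t * q ^ i * (qnum q (Suc j) * G i (Suc j)) + low1 G i j"
    and e2: "\<And>i j. z * G i j = qnum q (Suc j) * G i (Suc j)
      + t * q ^ j * (qnum q (Suc i) * G (Suc i) j) + low2 G i j"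
  shows "qpoch (t\<^sup>2) q n * kernel_poly G n r s = G 0 0 * moment_poly q t y z n r s"
proof (induction n arbitrary: r rule: less_induct)
  case (less n)
  show ?case
  proof (cases n)
    case 0
    then show ?thesis by (simp add: kernel_poly_def)
  next
    case (Suc m)
    define cp where "cp r = (case m of 0 \<Rightarrow> 0 | Suc k \<Rightarrow> kernel_poly G k r s)" for r
    define Rp where "Rp r = (case m of 0 \<Rightarrow> 0 | Suc k \<Rightarrow> (1 - t\<^sup>2 * q ^ k) * moment_poly q t y z k r s)" for r
    have c: "qpoch (t\<^sup>2) q m * kernel_poly G m r s = G 0 0 * moment_poly q t y z m r s" for r
      using less Suc by simp
    have p: "qpoch (t\<^sup>2) q m * cp r = G 0 0 * Rp r" for r
    proof (cases m)
      case (Suc k)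
      have "qpoch (t\<^sup>2) q k * kernel_poly G k r s = G 0 0 * moment_poly q t y z k r s"
        using less \<open>n = Suc m\<close> Suc by simp
      then show ?thesis by (simp add: cp_def Rp_def Suc qpoch_Suc)
    qed (simp add: cp_def Rp_def)
    have "qnum q (Suc m) * (qpoch (t\<^sup>2) q n * kernel_poly G n r s)
      = qpoch (t\<^sup>2) q m * ((1 - t\<^sup>2 * q ^ m) * qnum q (Suc m) * kernel_poly G (Suc m) r s)"
      by (simp add: Suc qpoch_Suc)
    also have "\<dots> = (r - t * s * q ^ m) * (y * (qpoch (t\<^sup>2) q m * kernel_poly G m r s) - r * (qpoch (t\<^sup>2) q m * cp r))
     + (s - t * r) * (z * (qpoch (t\<^sup>2) q m * kernel_poly G m (q * r) s) - s * (qpoch (t\<^sup>2) q m * cp (q * r)))"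
      unfolding kernel_poly_rec[OF e1 e2] cp_def by (simp add: algebra_simps)
    also have "\<dots> = G 0 0 * ((r - t * s * q ^ m) * (y * moment_poly q t y z m r s - r * Rp r)
     + (s - t * r) * (z * moment_poly q t y z m (q * r) s - s * Rp (q * r)))"
      unfolding c p by (simp add: algebra_simps)
    also have "\<dots> = qnum q (Suc m) * (G 0 0 * moment_poly q t y z n r s)"
      using moment_poly_rec[OF q, where n = m and t = t and y = y and z = z and r = r and s = s]
      by (simp add: Rp_def Suc)
    finally show ?thesis using qnum_Suc_neq_0[OF q] by simp
  qed
qed

section \<open>The Poisson--Mehler kernel\<close>

lemma sqrt_one_minus_q:
  fixes q :: real assumes "\<bar>q\<bar> < 1" shows "sqrt (1 - q) > 0" "(sqrt (1 - q))\<^sup>2 = 1 - q"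
  using assms by simp_all

text \<open>The Rogers-Szego form of the continuous q-Hermite polynomial, in real terms and divided
  by \<open>qfact q n\<close>.\<close>

definition cos_sum :: "real \<Rightarrow> nat \<Rightarrow> real \<Rightarrow> real" where
  "cos_sum q n \<theta> = (\<Sum>i\<le>n. cos ((real i - real (n - i)) * \<theta>) / (qfact q i * qfact q (n - i)))"

lemma cos_sum_rec:
  assumes q: "\<bar>q\<bar> < 1"
  shows "2 * cos \<theta> * cos_sum q (Suc n) \<theta> = qnum q (Suc (Suc n)) * cos_sum q (Suc (Suc n)) \<theta>
     + (1 - q) * cos_sum q n \<theta>"
proof -
  let ?c = "\<lambda>i j. cos ((real i - real j) * \<theta>)"
  let ?f = "\<lambda>i j. qfact q i * qfact q j"
  define N where "N = Suc n"
  have f0: "qfact q k \<noteq> 0" "qnum q (Suc k) \<noteq> 0" for k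
    using qfact_neq_0[OF q] qnum_Suc_neq_0[OF q] by auto
  have split: "qnum q (Suc N) * (?c i j / ?f i j) =
      qnum q i * (?c i j / ?f i j) + q ^ i * (qnum q j * (?c i j / ?f i j))"
    if "i + j = Suc N" for i j
  proof -
    have "qnum q (Suc N) = qnum q i + q ^ i * qnum q j"
      using that qnum_add[of q i j] by simp
    then show ?thesis by (simp only: distrib_right mult_ac)
  qed
  have "qnum q (Suc N) * cos_sum q (Suc N) \<theta> =
     (\<Sum>i\<le>Suc N. qnum q i * (?c i (Suc N - i) / ?f i (Suc N - i)))
     + (\<Sum>i\<le>Suc N. q ^ i * (qnum q (Suc N - i) * (?c i (Suc N - i) / ?f i (Suc N - i))))"
    unfolding cos_sum_def sum_distrib_left sum.distrib[symmetric]
    by (intro sum.cong refl split) auto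
  also have "(\<Sum>i\<le>Suc N. qnum q i * (?c i (Suc N - i) / ?f i (Suc N - i)))
     = (\<Sum>i\<le>N. ?c (Suc i) (N - i) / ?f i (N - i))"
    by (subst sum.atMost_Suc_shift) (simp add: qfact_Suc f0 del: of_nat_Suc)
  also have "(\<Sum>i\<le>Suc N. q ^ i * (qnum q (Suc N - i) * (?c i (Suc N - i) / ?f i (Suc N - i))))
     = (\<Sum>i\<le>N. q ^ i * (?c i (Suc (N - i)) / ?f i (N - i)))"
    by (auto simp: Suc_diff_le qfact_Suc f0 simp del: of_nat_Suc of_nat_diff intro!: sum.cong)
  finally have 1: "qnum q (Suc N) * cos_sum q (Suc N) \<theta> =
     (\<Sum>i\<le>N. ?c (Suc i) (N - i) / ?f i (N - i))
     + (\<Sum>i\<le>N. q ^ i * (?c i (Suc (N - i)) / ?f i (N - i)))" .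
  have cc: "2 * cos \<theta> * ?c i j = ?c (Suc i) j + ?c i (Suc j)" for i j
    using cos_add[of "(real i - real j) * \<theta>" \<theta>] cos_diff[of "(real i - real j) * \<theta>" \<theta>]
    by (simp add: algebra_simps)
  have "2 * cos \<theta> * cos_sum q N \<theta> = (\<Sum>i\<le>N. (2 * cos \<theta> * ?c i (N - i)) / ?f i (N - i))"
    by (simp add: cos_sum_def sum_distrib_left)
  also have "\<dots> = (\<Sum>i\<le>N. ?c (Suc i) (N - i) / ?f i (N - i))
     + (\<Sum>i\<le>N. ?c i (Suc (N - i)) / ?f i (N - i))"
    unfolding cc by (simp add: add_divide_distrib sum.distrib)
  finally have "2 * cos \<theta> * cos_sum q N \<theta> - qnum q (Suc N) * cos_sum q (Suc N) \<theta>
    = (\<Sum>i\<le>N. (1 - q ^ i) * (?c i (Suc (N - i)) / ?f i (N - i)))"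
    unfolding 1 left_diff_distrib sum_subtractf by simp
  \<comment> \<open>The term \<open>i = 0\<close> vanishes, and
    \<open>1 - q ^ i = (1 - q) * qnum q i\<close> cancels the last factor of
    \<open>qfact q i\<close>, which lowers the degree.\<close>
  also have "\<dots> = (\<Sum>i\<le>n. (1 - q) * (?c i (n - i) / ?f i (n - i)))"
    unfolding N_def by (subst sum.atMost_Suc_shift)
      (simp add: one_minus_times_qnum[symmetric] qfact_Suc f0 del: power_Suc)
  finally show ?thesis unfolding N_def by (simp add: cos_sum_def sum_distrib_left)
qed

lemma qHermite_cos:
  assumes q: "\<bar>q\<bar> < 1"
  shows "sqrt (1 - q) ^ n * qHermite q n (2 * cos \<theta> / sqrt (1 - q)) = qfact q n * cos_sum q n \<theta>"
proof (induction n rule: less_induct)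
  case (less n)
  let ?s = "sqrt (1 - q)"
  have s: "?s > 0" "?s * ?s = 1 - q" using sqrt_one_minus_q[OF q] by (auto simp: power2_eq_square)
  consider "n = 0" | "n = Suc 0" | m where "n = Suc (Suc m)" by (metis not0_implies_Suc)
  then show ?case
  proof cases
    case 1 then show ?thesis by (simp add: cos_sum_def)
  next
    case 2 then show ?thesis using s by (simp add: cos_sum_def qfact_Suc)
  next
    case 3
    let ?x = "2 * cos \<theta> / ?s"
    have "?s ^ n * qHermite q n ?x = 2 * cos \<theta> * (?s ^ Suc m * qHermite q (Suc m) ?x)
      - (?s * ?s) * qnum q (Suc m) * (?s ^ m * qHermite q m ?x)"
      unfolding 3 qHermite.simps right_diff_distrib using s(1) by simp
    also have "\<dots> = qfact q (Suc m) * (2 * cos \<theta> * cos_sum q (Suc m) \<theta>)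
      - (1 - q) * qnum q (Suc m) * (qfact q m * cos_sum q m \<theta>)"
      using less 3 by (simp only: s) simp
    also have "\<dots> = qfact q n * cos_sum q n \<theta>"
      unfolding cos_sum_rec[OF q] 3 by (simp add: qfact_Suc algebra_simps)
    finally show ?thesis .
  qed
qed

lemma cos_param:
  assumes q: "\<bar>q\<bar> < 1" and x: "x \<in> S q"
  obtains \<theta> where "x = 2 * cos \<theta> / sqrt (1 - q)"
proof -
  have s: "sqrt (1 - q) > 0" using sqrt_one_minus_q[OF q] by auto
  have "- 1 \<le> x * sqrt (1 - q) / 2" "x * sqrt (1 - q) / 2 \<le> 1"
    using x s by (simp_all add: S_def field_simps)
  then have "cos (arccos (x * sqrt (1 - q) / 2)) = x * sqrt (1 - q) / 2"
    by (rule cos_arccos)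
  then have "x = 2 * cos (arccos (x * sqrt (1 - q) / 2)) / sqrt (1 - q)"
    using s by (simp add: nonzero_eq_divide_eq)
  then show ?thesis by (rule that)
qed

section \<open>Growth estimates\<close>

lemma qpoch_qfact: "qpoch q q n = (1 - q) ^ n * qfact q n"
proof (induction n)
  case (Suc n)
  then show ?case using one_minus_times_qnum[of q "Suc n"]
    by (simp add: qpoch_Suc qfact_Suc)
qed simp

lemma abs_convergent_prod_qpoch:
  fixes a q :: real
  assumes q: "\<bar>q\<bar> < 1"
  shows "abs_convergent_prod (\<lambda>i. 1 - a * q ^ i)"
proof -
  have "summable (\<lambda>i. norm (a * q ^ i))"
    unfolding norm_mult norm_power using q by (intro summable_mult summable_geometric) (simp add: real_norm_def)
  then have "abs_convergent_prod (\<lambda>i. 1 + (- (a * q ^ i)))"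
    by (intro summable_imp_abs_convergent_prod) simp
  then show ?thesis by simp
qed

lemma qpoch_factor_pos:
  assumes q: "\<bar>q\<bar> < 1" and a: "\<bar>a\<bar> < 1"
  shows "1 - a * q ^ i > (0::real)"
proof -
  have "\<bar>a * q ^ i\<bar> \<le> \<bar>a\<bar> * 1"
    unfolding abs_mult power_abs using q by (intro mult_left_mono power_le_one) auto
  then show ?thesis using a by linarith
qed

lemma qpoch_pos:
  assumes "\<bar>q\<bar> < 1" "\<bar>a\<bar> < 1"
  shows "qpoch a q n > 0"
  unfolding qpoch_def using qpoch_factor_pos[OF assms] by (intro prod_pos) blast

lemma convergent_prod_LIMSEQ_lessThan:
  fixes f :: "nat \<Rightarrow> real"
  assumes "convergent_prod f"
  shows "(\<lambda>n. \<Prod>i<n. f i) \<longlonglongrightarrow> prodinf f"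
  by (rule LIMSEQ_imp_Suc) (use convergent_prod_LIMSEQ[OF assms] in \<open>simp add: lessThan_Suc_atMost\<close>)

lemma qpoch_LIMSEQ:
  assumes q: "\<bar>q\<bar> < 1"
  shows "(\<lambda>n. qpoch a q n) \<longlonglongrightarrow> qpoch_inf a q"
proof -
  have "convergent_prod (\<lambda>i. 1 - a * q ^ i)"
    using abs_convergent_prod_qpoch[OF q] by (rule abs_convergent_prod_imp_convergent_prod)
  then show ?thesis
    unfolding qpoch_def qpoch_inf_def by (rule convergent_prod_LIMSEQ_lessThan)
qed

lemma qpoch_inf_pos:
  assumes q: "\<bar>q\<bar> < 1" and a: "\<bar>a\<bar> < 1"
  shows "qpoch_inf a q > 0"
proof -
  have "convergent_prod (\<lambda>i. 1 - a * q ^ i)"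
    using abs_convergent_prod_qpoch[OF q] by (rule abs_convergent_prod_imp_convergent_prod)
  then have "qpoch_inf a q \<noteq> 0"
    unfolding qpoch_inf_def using qpoch_factor_pos[OF q a]
    by (metis less_numeral_extra(3) prodinf_nonzero)
  moreover have "qpoch_inf a q \<ge> 0"
    using qpoch_LIMSEQ[OF q] by (rule LIMSEQ_le_const) (auto intro!: less_imp_le qpoch_pos assms)
  ultimately show ?thesis by simp
qed

text \<open>By \<open>qpoch_qfact\<close> the rescaled q-factorials converge to
  \<open>qpoch_inf q q\<close>, which is positive; hence they and their reciprocals are
  bounded.\<close>

lemma qfact_bounds:
  assumes q: "\<bar>q\<bar> < 1"
  obtains K where "K > 0" "\<And>n. qfact q n \<le> K / (1 - q) ^ n" "\<And>n. inverse (qfact q n) \<le> K * (1 - q) ^ n"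
proof -
  have lim: "(\<lambda>n. qpoch q q n) \<longlonglongrightarrow> qpoch_inf q q" by (rule qpoch_LIMSEQ[OF q])
  have lim': "(\<lambda>n. inverse (qpoch q q n)) \<longlonglongrightarrow> inverse (qpoch_inf q q)"
    using qpoch_inf_pos[OF q q] by (intro tendsto_inverse lim) simp
  obtain K1 where K1: "K1 > 0" "\<And>n. norm (qpoch q q n) \<le> K1"
    using convergent_imp_Bseq[OF convergentI[OF lim]] by (auto elim: BseqE)
  obtain K2 where K2: "K2 > 0" "\<And>n. norm (inverse (qpoch q q n)) \<le> K2"
    using convergent_imp_Bseq[OF convergentI[OF lim']] by (auto elim: BseqE)
  have p: "(1 - q) ^ n > 0" for n using q by simp
  show ?thesis
  proof (rule that[of "max K1 K2"])
    show "max K1 K2 > 0" using K1 by simp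
    fix n
    have "qpoch q q n \<le> max K1 K2" using K1(2)[of n] by simp
    then show "qfact q n \<le> max K1 K2 / (1 - q) ^ n"
      using p[of n] by (simp add: qpoch_qfact field_simps)
    have "inverse (qpoch q q n) \<le> max K1 K2" using K2(2)[of n] by (simp only: real_norm_def)
    then have "inverse (qfact q n) * inverse ((1 - q) ^ n) \<le> max K1 K2"
      by (simp add: qpoch_qfact mult.commute)
    then show "inverse (qfact q n) \<le> max K1 K2 * (1 - q) ^ n"
      using p[of n] qfact_pos[OF q, of n] by (simp add: field_simps)
  qed
qed

text \<open>On \<open>S q\<close> the argument is \<open>2 * cos \<theta> / sqrt (1 - q)\<close>, so
  the polynomial is a sum of \<open>n + 1\<close> cosines with uniformly controlled coefficients.
  This gives the factor \<open>n + 1\<close>.\<close>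

lemma qHermite_bound:
  assumes q: "\<bar>q\<bar> < 1"
  obtains K where "K > 0" "\<And>n x. x \<in> S q \<Longrightarrow> \<bar>qHermite q n x\<bar> \<le> K * (real n + 1) / sqrt (1 - q) ^ n"
proof -
  obtain K where K: "K > 0" "\<And>n. qfact q n \<le> K / (1 - q) ^ n" "\<And>n. inverse (qfact q n) \<le> K * (1 - q) ^ n"
    using qfact_bounds[OF q] by blast
  have s: "sqrt (1 - q) > 0" "1 - q > 0" using q by auto
  show ?thesis
  proof (rule that[of "K * K * K"])
    show "K * K * K > 0" using K(1) by simp
    fix n x assume "x \<in> S q"
    then obtain \<theta> where x: "x = 2 * cos \<theta> / sqrt (1 - q)" using cos_param[OF q] by blast
    have "\<bar>cos_sum q n \<theta>\<bar> \<le> (\<Sum>i\<le>n. K * K * (1 - q) ^ n)"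
      unfolding cos_sum_def
    proof (intro order_trans[OF sum_abs] sum_mono)
      fix i assume i: "i \<in> {..n}"
      have "\<bar>cos ((real i - real (n - i)) * \<theta>) / (qfact q i * qfact q (n - i))\<bar>
         \<le> 1 * (inverse (qfact q i) * inverse (qfact q (n - i)))"
        unfolding abs_mult divide_inverse
        using qfact_pos[OF q, of i] qfact_pos[OF q, of "n - i"]
        by (intro mult_mono) (auto simp: abs_mult)
      also have "\<dots> \<le> 1 * ((K * (1 - q) ^ i) * (K * (1 - q) ^ (n - i)))"
        using qfact_pos[OF q, of i] qfact_pos[OF q, of "n - i"] K s
        by (intro mult_mono K(3)) (auto intro!: mult_nonneg_nonneg)
      also have "\<dots> = K * K * ((1 - q) ^ i * (1 - q) ^ (n - i))" by simp
      also have "(1 - q) ^ i * (1 - q) ^ (n - i) = (1 - q) ^ n"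
        using i by (simp add: power_add[symmetric])
      finally show "\<bar>cos ((real i - real (n - i)) * \<theta>) / (qfact q i * qfact q (n - i))\<bar>
        \<le> K * K * (1 - q) ^ n" .
    qed
    then have h: "\<bar>cos_sum q n \<theta>\<bar> \<le> (real n + 1) * (K * K * (1 - q) ^ n)" by (simp add: add.commute)
    have "sqrt (1 - q) ^ n * \<bar>qHermite q n x\<bar> = qfact q n * \<bar>cos_sum q n \<theta>\<bar>"
      using arg_cong[OF qHermite_cos[OF q, of n \<theta>], of abs] s qfact_pos[OF q, of n]
      by (simp add: x abs_mult)
    also have "\<dots> \<le> (K / (1 - q) ^ n) * ((real n + 1) * (K * K * (1 - q) ^ n))"
      using h K qfact_pos[OF q, of n] s by (intro mult_mono) (auto intro: less_imp_le)
    also have "\<dots> = K * K * K * (real n + 1)" using s by simp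
    finally show "\<bar>qHermite q n x\<bar> \<le> K * K * K * (real n + 1) / sqrt (1 - q) ^ n"
      using s by (simp add: pos_le_divide_eq mult.commute)
  qed
qed

text \<open>Comparison with the twice differentiated geometric series, whose coefficients are
  \<open>(m + 1) * (m + 2)\<close>.\<close>

lemma summable_poly_geometric:
  fixes t :: real
  assumes t: "\<bar>t\<bar> < 1"
  shows "summable (\<lambda>m. \<bar>t\<bar> ^ m * ((real m + (real i + 1)) * (real m + (real j + 1))))"
proof -
  have geo: "summable (\<lambda>n. 1 * x ^ n)" if "norm x < 1" for x :: real
    using that by (simp add: summable_geometric)
  have d1: "summable (\<lambda>n. diffs (\<lambda>_. 1) n * x ^ n)" if "norm x < 1" for x :: real
    using that geo by (rule termdiff_converges)
  have "summable (\<lambda>n. diffs (diffs (\<lambda>_. 1)) n * \<bar>t\<bar> ^ n)"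
    using d1 t by (intro termdiff_converges[where K = 1]) auto
  then have "summable (\<lambda>m. (real i + 1) * (real j + 1) * (diffs (diffs (\<lambda>_. 1)) m * \<bar>t\<bar> ^ m))"
    by (rule summable_mult)
  then show ?thesis
  proof (rule summable_comparison_test'[where N = 0])
    fix m :: nat
    have "real m + (real i + 1) \<le> (real i + 1) * (real m + 1)"
      "real m + (real j + 1) \<le> (real j + 1) * (real m + 2)"
      by (simp_all add: algebra_simps)
    then have "(real m + (real i + 1)) * (real m + (real j + 1))
      \<le> ((real i + 1) * (real m + 1)) * ((real j + 1) * (real m + 2))"
      by (intro mult_mono) auto
    then have "\<bar>t\<bar> ^ m * ((real m + (real i + 1)) * (real m + (real j + 1)))
      \<le> \<bar>t\<bar> ^ m * (((real i + 1) * (real m + 1)) * ((real j + 1) * (real m + 2)))"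
      by (intro mult_left_mono) auto
    then show "norm (\<bar>t\<bar> ^ m * ((real m + (real i + 1)) * (real m + (real j + 1))))
      \<le> (real i + 1) * (real j + 1) * (diffs (diffs (\<lambda>_. 1)) m * \<bar>t\<bar> ^ m)"
      by (simp add: diffs_def abs_mult algebra_simps)
  qed
qed

text \<open>The bound is uniform in \<open>y\<close> and \<open>z\<close>, so that it also serves as a Weierstrass majorant.\<close>

lemma kernel_majorant:
  assumes q: "\<bar>q\<bar> < 1"
  obtains K where "K > 0" "\<And>m i j t y z. y \<in> S q \<Longrightarrow> z \<in> S q \<Longrightarrow>
     \<bar>t ^ m / qfact q m * qHermite q (m + i) y * qHermite q (m + j) z\<bar>
       \<le> K / sqrt (1 - q) ^ (i + j) * (\<bar>t\<bar> ^ m * ((real m + (real i + 1)) * (real m + (real j + 1))))"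
proof -
  obtain K where K: "K > 0" "\<And>n. qfact q n \<le> K / (1 - q) ^ n" "\<And>n. inverse (qfact q n) \<le> K * (1 - q) ^ n"
    using qfact_bounds[OF q] by blast
  obtain L where L: "L > 0" "\<And>n x. x \<in> S q \<Longrightarrow> \<bar>qHermite q n x\<bar> \<le> L * (real n + 1) / sqrt (1 - q) ^ n"
    using qHermite_bound[OF q] by blast
  have s: "sqrt (1 - q) > 0" "1 - q > 0" "sqrt (1 - q) * sqrt (1 - q) = 1 - q" using q by auto
  show ?thesis
  proof (rule that[of "K * L * L"])
    show "K * L * L > 0" using K L by simp
    fix m i j t y z assume yz: "y \<in> S q" "z \<in> S q"
    have "\<bar>t ^ m / qfact q m * qHermite q (m + i) y * qHermite q (m + j) z\<bar>
      = \<bar>t\<bar> ^ m * inverse (qfact q m) * \<bar>qHermite q (m + i) y\<bar> * \<bar>qHermite q (m + j) z\<bar>"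
      using qfact_pos[OF q, of m] by (simp add: abs_mult power_abs divide_inverse)
    also have "\<dots> \<le> \<bar>t\<bar> ^ m * (K * (1 - q) ^ m) * (L * (real (m + i) + 1) / sqrt (1 - q) ^ (m + i))
      * (L * (real (m + j) + 1) / sqrt (1 - q) ^ (m + j))"
      using K(1) L(1) s(1,2) qfact_pos[OF q, of m]
      by (intro mult_mono L(2) yz K(3) order_refl) (auto intro!: mult_nonneg_nonneg divide_nonneg_nonneg)
    also have "\<dots> = K * L * L / sqrt (1 - q) ^ (i + j) *
      (\<bar>t\<bar> ^ m * ((real m + (real i + 1)) * (real m + (real j + 1))))"
    proof -
      have "(1 - q) ^ m = sqrt (1 - q) ^ m * sqrt (1 - q) ^ m"
        by (simp only: power_mult_distrib[symmetric] s(3))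
      then show ?thesis using s(1) by (simp add: power_add field_simps)
    qed
    finally show "\<bar>t ^ m / qfact q m * qHermite q (m + i) y * qHermite q (m + j) z\<bar>
       \<le> K * L * L / sqrt (1 - q) ^ (i + j) * (\<bar>t\<bar> ^ m * ((real m + (real i + 1)) * (real m + (real j + 1))))" .
  qed
qed

section \<open>Contiguous relations of the shifted Mehler kernels\<close>

definition mehler :: "real \<Rightarrow> real \<Rightarrow> real \<Rightarrow> real \<Rightarrow> nat \<Rightarrow> nat \<Rightarrow> real" where
  "mehler q t y z i j = (\<Sum>m. t ^ m / qfact q m * qHermite q (m + i) y * qHermite q (m + j) z)"

lemma summable_mehler:
  assumes q: "\<bar>q\<bar> < 1" and t: "\<bar>t\<bar> < 1" and yz: "y \<in> S q" "z \<in> S q"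
  shows "summable (\<lambda>m. t ^ m / qfact q m * qHermite q (m + i) y * qHermite q (m + j) z)"
proof -
  obtain K where K: "K > 0" "\<And>m i j t y z. y \<in> S q \<Longrightarrow> z \<in> S q \<Longrightarrow>
     \<bar>t ^ m / qfact q m * qHermite q (m + i) y * qHermite q (m + j) z\<bar>
       \<le> K / sqrt (1 - q) ^ (i + j) * (\<bar>t\<bar> ^ m * ((real m + (real i + 1)) * (real m + (real j + 1))))"
    using kernel_majorant[OF q] by blast
  show ?thesis
    using summable_mult[OF summable_poly_geometric[OF t]]
    by (rule summable_comparison_test'[where N = 0]) (unfold real_norm_def, rule K(2)[OF yz])
qed

lemma mehler_commute: "mehler q t y z i j = mehler q t z y j i"
  by (simp add: mehler_def mult_ac)

text \<open>In the three-term recurrence at index \<open>m + i\<close>,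
  \<open>qnum q (m + i)\<close> splits into \<open>qnum q i + q ^ i * qnum q m\<close>. The part
  with \<open>qnum q m\<close> cancels a factor of \<open>qfact q m\<close> and shifts the
  summation, which yields \<open>t\<close> and raises \<open>j\<close>. The truncated
  \<open>m - 1\<close> and \<open>i - 1\<close> are harmless at 0, where their coefficient is
  \<open>qnum q 0\<close>.\<close>

lemma mehler_rec:
  assumes q: "\<bar>q\<bar> < 1" and t: "\<bar>t\<bar> < 1" and yz: "y \<in> S q" "z \<in> S q"
  shows "y * mehler q t y z i j = mehler q t y z (Suc i) j + t * q ^ i * mehler q t y z i (Suc j)
    + qnum q i * mehler q t y z (i - 1) j"
proof -
  let ?a = "\<lambda>m. t ^ m / qfact q m"
  let ?H = "qHermite q"
  let ?h = "\<lambda>i j m. ?a m * ?H (m + i) y * ?H (m + j) z"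
  have S: "?h i j sums mehler q t y z i j" for i j
    unfolding mehler_def by (intro summable_sums summable_mehler assms)
  have sh: "(\<lambda>m. ?a m * qnum q m * ?H (m - 1 + i) y * ?H (m + j) z) sums (t * mehler q t y z i (Suc j))"
  proof -
    have "?a (Suc m) * qnum q (Suc m) = t * ?a m" for m
      using qfact_neq_0[OF q] qnum_Suc_neq_0[OF q] by (simp add: qfact_Suc)
    then have "(\<lambda>m. ?a (Suc m) * qnum q (Suc m) * ?H (m + i) y * ?H (Suc (m + j)) z)
      = (\<lambda>m. t * ?h i (Suc j) m)"
      by (simp only: mult.assoc) simp
    then have "(\<lambda>m. ?a (Suc m) * qnum q (Suc m) * ?H (Suc m - 1 + i) y * ?H (Suc m + j) z) sums
       (t * mehler q t y z i (Suc j))"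
      using sums_mult[OF S[of i "Suc j"], of t] by simp
    then show ?thesis by (drule_tac sums_Suc) simp
  qed
  have pt: "y * ?h i j m = ?h (Suc i) j m + q ^ i * (?a m * qnum q m * ?H (m - 1 + i) y * ?H (m + j) z)
      + qnum q i * ?h (i - 1) j m" for m
  proof -
    have "y * ?H (m + i) y = ?H (Suc (m + i)) y + (q ^ i * qnum q m + qnum q i) * ?H (m + i - 1) y"
      using qnum_add[of q i m] by (simp add: mult_qHermite add_ac)
    also have "(q ^ i * qnum q m + qnum q i) * ?H (m + i - 1) y
      = q ^ i * qnum q m * ?H (m - 1 + i) y + qnum q i * ?H (m + (i - 1)) y"
      by (cases m; cases i) (simp_all add: distrib_right)
    finally have 1: "y * ?H (m + i) y = ?H (Suc (m + i)) y
      + (q ^ i * qnum q m * ?H (m - 1 + i) y + qnum q i * ?H (m + (i - 1)) y)" .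
    have "y * ?h i j m = ?a m * (y * ?H (m + i) y) * ?H (m + j) z" by simp
    then show ?thesis unfolding 1 by (simp add: algebra_simps)
  qed
  have "(\<lambda>m. y * ?h i j m) sums (mehler q t y z (Suc i) j + q ^ i * (t * mehler q t y z i (Suc j))
    + qnum q i * mehler q t y z (i - 1) j)"
    unfolding pt by (intro sums_add sums_mult S sh)
  moreover have "(\<lambda>m. y * ?h i j m) sums (y * mehler q t y z i j)"
    by (intro sums_mult S)
  ultimately show ?thesis by (simp add: sums_iff mult_ac)
qed

text \<open>Dividing by the q-factorials of both indices brings the kernels into the form assumed by
  \<open>kernel_poly_eq_moment_poly\<close>.\<close>

lemma hat_mehler_rec:
  fixes q t y z
  assumes q: "\<bar>q\<bar> < 1" and t: "\<bar>t\<bar> < 1" and yz: "y \<in> S q" "z \<in> S q"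
  defines "G \<equiv> \<lambda>i j. mehler q t y z i j / (qfact q i * qfact q j)"
  shows "y * G i j = qnum q (Suc i) * G (Suc i) j + t * q ^ i * (qnum q (Suc j) * G i (Suc j)) + low1 G i j"
    and "z * G i j = qnum q (Suc j) * G i (Suc j) + t * q ^ j * (qnum q (Suc i) * G (Suc i) j) + low2 G i j"
proof -
  have f0: "qfact q k \<noteq> 0" "qnum q (Suc k) \<noteq> 0" for k
    using qfact_neq_0[OF q] qnum_Suc_neq_0[OF q] by auto
  have up: "qnum q (Suc i) * G (Suc i) j = mehler q t y z (Suc i) j / (qfact q i * qfact q j)"
    "qnum q (Suc j) * G i (Suc j) = mehler q t y z i (Suc j) / (qfact q i * qfact q j)" for i j
    by (simp_all add: G_def qfact_Suc f0)
  have lo: "low1 G i j = qnum q i * mehler q t y z (i - 1) j / (qfact q i * qfact q j)"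
    "low2 G i j = qnum q j * mehler q t y z i (j - 1) / (qfact q i * qfact q j)" for i j
    by (cases i, simp_all add: G_def qfact_Suc f0) (cases j, simp_all add: G_def qfact_Suc f0)
  show "y * G i j = qnum q (Suc i) * G (Suc i) j + t * q ^ i * (qnum q (Suc j) * G i (Suc j)) + low1 G i j"
    using arg_cong[OF mehler_rec[OF q t yz, of i j], of "\<lambda>u. u / (qfact q i * qfact q j)"]
    unfolding up lo by (simp add: G_def add_divide_distrib)
  show "z * G i j = qnum q (Suc j) * G i (Suc j) + t * q ^ j * (qnum q (Suc i) * G (Suc i) j) + low2 G i j"
    using arg_cong[OF mehler_rec[OF q t yz(2,1), of j i], of "\<lambda>u. u / (qfact q i * qfact q j)"]
    unfolding up lo by (simp add: G_def add_divide_distrib mehler_commute[of q t y z])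
qed

text \<open>Write \<open>q ^ m\<close> as \<open>1 - (1 - q) * qnum q m\<close>; the second part
  shifts the summation by one and raises both indices.\<close>

lemma mehler_q_scale:
  assumes q: "\<bar>q\<bar> < 1" and t: "\<bar>t\<bar> < 1" and yz: "y \<in> S q" "z \<in> S q"
  shows "mehler q (q * t) y z 0 0 = mehler q t y z 0 0 - (1 - q) * t * mehler q t y z 1 1"
proof -
  let ?H = "qHermite q"
  have S: "(\<lambda>m. t ^ m / qfact q m * ?H (m + i) y * ?H (m + j) z) sums mehler q t y z i j" for i j
    unfolding mehler_def by (intro summable_sums summable_mehler assms)
  have "t ^ Suc m / qfact q (Suc m) * qnum q (Suc m) * ?H (Suc m) y * ?H (Suc m) z
    = t * (t ^ m / qfact q m * ?H (m + 1) y * ?H (m + 1) z)" for m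
    using qfact_neq_0[OF q] qnum_Suc_neq_0[OF q] by (simp add: qfact_Suc)
  then have "(\<lambda>m. t ^ Suc m / qfact q (Suc m) * qnum q (Suc m) * ?H (Suc m) y * ?H (Suc m) z)
      sums (t * mehler q t y z 1 1)"
    using sums_mult[OF S[of 1 1], of t] by simp
  then have "(\<lambda>m. t ^ m / qfact q m * qnum q m * ?H m y * ?H m z) sums (t * mehler q t y z 1 1)"
    by (drule_tac sums_Suc) simp
  then have "(\<lambda>m. t ^ m / qfact q m * ?H (m + 0) y * ?H (m + 0) z
      - (1 - q) * (t ^ m / qfact q m * qnum q m * ?H m y * ?H m z))
    sums (mehler q t y z 0 0 - (1 - q) * (t * mehler q t y z 1 1))"
    by (intro sums_diff sums_mult S)
  moreover have "t ^ m / qfact q m * ?H (m + 0) y * ?H (m + 0) z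
      - (1 - q) * (t ^ m / qfact q m * qnum q m * ?H m y * ?H m z)
    = (q * t) ^ m / qfact q m * ?H (m + 0) y * ?H (m + 0) z" for m
  proof -
    have "t ^ m / qfact q m * ?H (m + 0) y * ?H (m + 0) z
      - (1 - q) * (t ^ m / qfact q m * qnum q m * ?H m y * ?H m z)
      = (1 - (1 - q) * qnum q m) * (t ^ m / qfact q m * ?H m y * ?H m z)"
      by (simp add: algebra_simps diff_divide_distrib add_divide_distrib)
    then show ?thesis by (simp add: one_minus_times_qnum power_mult_distrib)
  qed
  ultimately show ?thesis unfolding mehler_def by (simp add: sums_iff)
qed

lemma mehler_functional_eq:
  assumes q: "\<bar>q\<bar> < 1" and t: "\<bar>t\<bar> < 1" and yz: "y \<in> S q" "z \<in> S q"
  shows "mehler q (q * t) y z 0 0 * ((1 - t\<^sup>2) * (1 - q * t\<^sup>2)) = mehler q t y z 0 0 * w 0 y z t q"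
proof -
  define a b c d e where "a = mehler q t y z 0 0" "b = mehler q t y z 0 1" "c = mehler q t y z 1 0"
    "d = mehler q t y z 1 1" "e = mehler q t y z 0 2"
  note defs = this
  have 1: "y * a = c + t * b"
    using mehler_rec[OF q t yz, of 0 0] by (simp add: defs)
  have 2: "z * a = b + t * c"
    using mehler_rec[OF q t yz(2,1), of 0 0] by (simp add: defs mehler_commute[of q t z y])
  have 3: "y * b = d + t * e"
    using mehler_rec[OF q t yz, of 0 1] by (simp add: defs numeral_2_eq_2)
  have 4: "z * b = e + t * q * d + a"
    using mehler_rec[OF q t yz(2,1), of 1 0] by (simp add: defs mehler_commute[of q t z y] numeral_2_eq_2)
  \<comment> \<open>Relations 1 and 2 eliminate \<open>c\<close>, relations 3 and 4 eliminate
    \<open>e\<close>. This expresses \<open>b\<close> and then \<open>d\<close> through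
    \<open>a\<close>, and the two determinants become the factors on the left of the functional
    equation.\<close>
  have b: "(1 - t\<^sup>2) * b = (z - t * y) * a"
    using 1 2 by algebra
  have d: "(1 - q * t\<^sup>2) * d = (y - t * z) * b + t * a"
    using 3 4 by algebra
  have "(a - (1 - q) * t * d) * ((1 - t\<^sup>2) * (1 - q * t\<^sup>2))
     = a * ((1 - t\<^sup>2)\<^sup>2 - (1 - q) * t * (1 + t\<^sup>2) * y * z + (1 - q) * t\<^sup>2 * (y\<^sup>2 + z\<^sup>2))"
    using b d by algebra
  then show ?thesis by (simp add: mehler_q_scale[OF q t yz] w_def defs)
qed

section \<open>The product formula for the kernel\<close>

lemma w_shift: "w k y z t q = w 0 y z (t * q ^ k) q"
  by (simp add: w_def power_mult_distrib power_mult[symmetric] mult.commute[of k 2])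

text \<open>With cosines for \<open>y\<close> and \<open>z\<close>, the expression is a strictly
  positive term plus a nonnegative multiple of a square; strictness comes from
  \<open>\<bar>t\<bar> < 1\<close>.\<close>

lemma w_0_pos:
  assumes q: "\<bar>q\<bar> < 1" and t: "\<bar>t\<bar> < 1" and yz: "y \<in> S q" "z \<in> S q"
  shows "w 0 y z t q > 0"
proof -
  obtain \<alpha> where y: "y = 2 * cos \<alpha> / sqrt (1 - q)" using cos_param[OF q yz(1)] by blast
  obtain \<beta> where z: "z = 2 * cos \<beta> / sqrt (1 - q)" using cos_param[OF q yz(2)] by blast
  have s: "sqrt (1 - q) > 0" "(1 - q) = sqrt (1 - q) * sqrt (1 - q)" using q by auto
  define Y Z where "Y = cos \<alpha>" "Z = cos \<beta>"
  have "\<bar>Y\<bar> \<le> 1" "\<bar>Z\<bar> \<le> 1" by (simp_all add: Y_Z_def)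
  then have "\<bar>Y\<bar> * \<bar>Z\<bar> \<le> 1 * 1" by (intro mult_mono) auto
  then have YZ: "\<bar>Y * Z\<bar> \<le> 1" by (simp add: abs_mult)
  have w: "w 0 y z t q = (1 - t\<^sup>2)\<^sup>2 - 4 * t * (1 + t\<^sup>2) * (Y * Z) + 4 * t\<^sup>2 * (Y\<^sup>2 + Z\<^sup>2)"
  proof -
    have scaled: "(1 - q) * (y * z) = 4 * (Y * Z)" "(1 - q) * y\<^sup>2 = 4 * Y\<^sup>2" "(1 - q) * z\<^sup>2 = 4 * Z\<^sup>2"
      using s(1,2) unfolding y z Y_Z_def by (simp_all add: power2_eq_square)
    have "w 0 y z t q = (1 - t\<^sup>2)\<^sup>2 - t * (1 + t\<^sup>2) * ((1 - q) * (y * z))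
      + t\<^sup>2 * ((1 - q) * y\<^sup>2 + (1 - q) * z\<^sup>2)"
      by (simp add: w_def algebra_simps)
    then show ?thesis unfolding scaled by (simp add: algebra_simps)
  qed
  define v where "v = \<bar>t\<bar>"
  have v: "0 \<le> v" "v < 1" "v\<^sup>2 = t\<^sup>2" using t by (auto simp: v_def)
  \<comment> \<open>Replacing \<open>Z\<close> by \<open>- Z\<close> when \<open>t\<close> is
    negative allows \<open>t\<close> to be exchanged for its absolute value \<open>v\<close>;
    \<open>P\<close> and \<open>D\<close> are the product and the difference after that
    change.\<close>
  define P where "P = (if t \<ge> 0 then Y * Z else - (Y * Z))"
  define D where "D = (if t \<ge> 0 then Y - Z else Y + Z)"
  have P: "t * (Y * Z) = v * P" "P \<le> 1" using YZ by (auto simp: P_def v_def)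
  have D: "Y\<^sup>2 + Z\<^sup>2 = D\<^sup>2 + 2 * P" by (simp add: D_def P_def power2_eq_square algebra_simps)
  have "w 0 y z t q = (1 - v\<^sup>2)\<^sup>2 - 4 * (1 + v\<^sup>2) * (t * (Y * Z)) + 4 * v\<^sup>2 * (Y\<^sup>2 + Z\<^sup>2)"
    unfolding w v(3) by (simp add: algebra_simps)
  also have "\<dots> = (1 - v)\<^sup>2 * ((1 - v)\<^sup>2 + 4 * v * (1 - P)) + 4 * v\<^sup>2 * D\<^sup>2"
    unfolding P D by (simp add: power2_eq_square algebra_simps)
  also have "\<dots> > 0"
    using v P by (intro add_pos_nonneg mult_pos_pos) auto
  finally show ?thesis .
qed

lemma abs_mult_power_less_1:
  fixes q t :: real
  assumes "\<bar>q\<bar> < 1" "\<bar>t\<bar> < 1" shows "\<bar>t * q ^ k\<bar> < 1"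
proof -
  have "\<bar>t * q ^ k\<bar> \<le> \<bar>t\<bar> * 1"
    unfolding abs_mult power_abs using assms by (intro mult_left_mono power_le_one) auto
  then show ?thesis using assms by linarith
qed

lemma w_pos:
  assumes "\<bar>q\<bar> < 1" and "\<bar>t\<bar> < 1" and "y \<in> S q" "z \<in> S q"
  shows "w k y z t q > 0"
  by (subst w_shift) (intro w_0_pos abs_mult_power_less_1 assms)

text \<open>\<open>w k y z t q - 1\<close> is a polynomial in \<open>q ^ k\<close> without constant
  term, hence dominated by geometric series.\<close>

lemma convergent_prod_w:
  assumes q: "\<bar>q\<bar> < 1"
  shows "convergent_prod (\<lambda>k. w k y z t q)"
proof -
  define A B D where "A = - 2 * t\<^sup>2 + (1 - q) * t\<^sup>2 * (y\<^sup>2 + z\<^sup>2)" "B = - (1 - q) * t * y * z" "D = t ^ 4"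
  have eq: "w k y z t q - 1 = A * (q ^ 2) ^ k + D * (q ^ 4) ^ k + B * (q ^ 1) ^ k + B * t\<^sup>2 * (q ^ 3) ^ k" for k
  proof -
    define Q where "Q = q ^ k"
    have Q: "(q ^ n) ^ k = Q ^ n" "q ^ (2 * k) = Q ^ 2" for n
      by (simp_all add: Q_def power_mult[symmetric] mult.commute)
    show ?thesis unfolding w_def A_B_D_def Q Q_def[symmetric] by algebra
  qed
  have sm: "summable (\<lambda>k. norm (c * (q ^ n) ^ k))" if "n > 0" for c n
  proof -
    have "norm (q ^ n) < 1" using q that by (simp add: power_abs power_less_one_iff)
    then show ?thesis unfolding norm_mult norm_power[of "q ^ n"]
      by (intro summable_mult summable_geometric) simp
  qed
  have "summable (\<lambda>k. norm (w k y z t q - 1))"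
  proof (rule summable_comparison_test'[where N = 0])
    show "summable (\<lambda>k. norm (A * (q ^ 2) ^ k) + norm (D * (q ^ 4) ^ k) + norm (B * (q ^ 1) ^ k)
        + norm (B * t\<^sup>2 * (q ^ 3) ^ k))"
      by (intro summable_add sm) simp_all
    show "norm (norm (w k y z t q - 1)) \<le> norm (A * (q ^ 2) ^ k) + norm (D * (q ^ 4) ^ k)
        + norm (B * (q ^ 1) ^ k) + norm (B * t\<^sup>2 * (q ^ 3) ^ k)" for k
      unfolding eq real_norm_def by linarith
  qed
  then have "abs_convergent_prod (\<lambda>k. w k y z t q)"
    by (simp add: abs_convergent_prod_conv_summable)
  then show ?thesis by (rule abs_convergent_prod_imp_convergent_prod)
qed

text \<open>Each application of the functional equation at \<open>t * q ^ N\<close> contributes the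
  two consecutive factors of index \<open>2 * N\<close> and \<open>2 * N + 1\<close>, hence the
  length \<open>2 * N\<close>.\<close>

lemma mehler_iterate:
  assumes q: "\<bar>q\<bar> < 1" and t: "\<bar>t\<bar> < 1" and yz: "y \<in> S q" "z \<in> S q"
  shows "mehler q (t * q ^ N) y z 0 0 * qpoch (t\<^sup>2) q (2 * N) = mehler q t y z 0 0 * (\<Prod>k<N. w k y z t q)"
proof (induction N)
  case (Suc N)
  let ?u = "t * q ^ N"
  have u: "\<bar>?u\<bar> < 1" by (rule abs_mult_power_less_1[OF q t])
  have "mehler q (t * q ^ Suc N) y z 0 0 * qpoch (t\<^sup>2) q (2 * Suc N) =
     mehler q (q * ?u) y z 0 0 * ((1 - ?u\<^sup>2) * (1 - q * ?u\<^sup>2)) * qpoch (t\<^sup>2) q (2 * N)"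
    by (simp add: qpoch_Suc power_mult_distrib power_mult[symmetric] mult_ac)
  also have "\<dots> = mehler q ?u y z 0 0 * qpoch (t\<^sup>2) q (2 * N) * w N y z t q"
    unfolding mehler_functional_eq[OF q u yz] w_shift[of N] by simp
  finally show ?case using Suc by simp
qed simp

lemma Poisson_Mehler:
  assumes q: "\<bar>q\<bar> < 1" and t: "\<bar>t\<bar> < 1" and yz: "y \<in> S q" "z \<in> S q"
  shows "mehler q t y z 0 0 = qpoch_inf (t\<^sup>2) q / (\<Prod>k. w k y z t q)"
proof -
  \<comment> \<open>As \<open>t * q ^ N\<close> tends to 0, the kernel only has to be continuous in
    its parameter at 0. It is a power series there, and 1/2 is an arbitrary point inside its disc of
    convergence.\<close>
  have "isCont (\<lambda>x. \<Sum>m. (qHermite q m y * qHermite q m z / qfact q m) * x ^ m) 0"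
    using summable_mehler[OF q _ yz, of "1/2" 0 0]
    by (intro isCont_powser[where K = "1/2"]) (simp_all add: mult_ac)
  then have cont: "isCont (\<lambda>x. mehler q x y z 0 0) 0"
    by (simp add: mehler_def mult_ac)
  have "(\<lambda>N. t * q ^ N) \<longlonglongrightarrow> t * 0"
    using q by (intro tendsto_mult tendsto_const LIMSEQ_power_zero) simp
  then have "(\<lambda>N. mehler q (t * q ^ N) y z 0 0) \<longlonglongrightarrow> mehler q 0 y z 0 0"
    by (intro isCont_tendsto_compose[OF cont]) simp
  moreover have "mehler q 0 y z 0 0 = 1"
    unfolding mehler_def by (subst suminf_finite[of "{0}"]) auto
  moreover have "(\<lambda>N. qpoch (t\<^sup>2) q (2 * N)) \<longlonglongrightarrow> qpoch_inf (t\<^sup>2) q"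
    using LIMSEQ_subseq_LIMSEQ[OF qpoch_LIMSEQ[OF q], of "\<lambda>N. 2 * N" "t\<^sup>2"]
    by (simp add: strict_mono_def o_def)
  ultimately have "(\<lambda>N. mehler q (t * q ^ N) y z 0 0 * qpoch (t\<^sup>2) q (2 * N)) \<longlonglongrightarrow> 1 * qpoch_inf (t\<^sup>2) q"
    by (intro tendsto_mult) simp_all
  moreover have "(\<lambda>N. mehler q t y z 0 0 * (\<Prod>k<N. w k y z t q)) \<longlonglongrightarrow> mehler q t y z 0 0 * (\<Prod>k. w k y z t q)"
    by (intro tendsto_mult tendsto_const convergent_prod_LIMSEQ_lessThan convergent_prod_w q)
  ultimately have "qpoch_inf (t\<^sup>2) q = mehler q t y z 0 0 * (\<Prod>k. w k y z t q)"
    using LIMSEQ_unique by (auto simp: mehler_iterate[OF q t yz])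
  moreover have "(\<Prod>k. w k y z t q) \<noteq> 0"
  proof (rule prodinf_nonzero[OF convergent_prod_w[OF q]])
    show "w k y z t q \<noteq> 0" for k using w_pos[OF q t yz, of k] by simp
  qed
  ultimately show ?thesis by simp
qed

section \<open>Orthogonality\<close>

text \<open>The variable \<open>v\<close> stands for \<open>(1 - q) * x\<^sup>2\<close>, that is
  \<open>(2 * cos \<theta>)\<^sup>2\<close>, so that one estimate on \<open>{0..4}\<close> serves
  both parametrizations.\<close>

definition weight_factor :: "real \<Rightarrow> nat \<Rightarrow> real \<Rightarrow> real" where
  "weight_factor q k v = (1 + q ^ k)\<^sup>2 - v * q ^ k"

lemma weight_factor_bound:
  assumes q: "\<bar>q\<bar> < 1" and v: "v \<in> {0..4}"
  shows "\<bar>weight_factor q k v - 1\<bar> \<le> 7 * \<bar>q\<bar> ^ k"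
proof -
  have p: "\<bar>q ^ k\<bar> \<le> 1" unfolding power_abs using q by (intro power_le_one) auto
  have "weight_factor q k v - 1 = q ^ k * (q ^ k + (2 - v))"
    by (simp add: weight_factor_def power2_eq_square algebra_simps)
  \<comment> \<open>The crude triangle inequality: 7 = 1 + 2 + 4.\<close>
  also have "\<bar>\<dots>\<bar> \<le> \<bar>q ^ k\<bar> * 7"
    unfolding abs_mult using p v by (intro mult_left_mono) auto
  finally show ?thesis by (simp add: power_abs)
qed

lemma convergent_prod_weight_factor:
  assumes q: "\<bar>q\<bar> < 1" and v: "v \<in> {0..4}"
  shows "convergent_prod (\<lambda>k. weight_factor q (k + j) v)"
proof -
  have "summable (\<lambda>k. 7 * \<bar>q\<bar> ^ k)" using q by (intro summable_mult summable_geometric) simp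
  then have "summable (\<lambda>k. norm (weight_factor q k v - 1))"
    by (rule summable_comparison_test'[where N = 0]) (use weight_factor_bound[OF q v] in simp)
  then have "abs_convergent_prod (\<lambda>k. weight_factor q k v)"
    by (simp add: abs_convergent_prod_conv_summable)
  then have "convergent_prod (\<lambda>k. weight_factor q k v)" by (rule abs_convergent_prod_imp_convergent_prod)
  then show ?thesis using convergent_prod_iff_shift[of "\<lambda>k. weight_factor q k v" j] by blast
qed

text \<open>The offset \<open>j\<close> is 0 for the full product and 1 for the product without the
  factor that vanishes at \<open>v = 4\<close>.\<close>

lemma uniform_limit_weight_factor:
  assumes q: "\<bar>q\<bar> < 1"
  shows "uniform_limit {0..4} (\<lambda>n v. \<Prod>k<n. weight_factor q (k + j) v) (\<lambda>v. \<Prod>k. weight_factor q (k + j) v) sequentially"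
proof -
  have sm: "summable (\<lambda>k. 7 * \<bar>q\<bar> ^ (k + j))"
    using q by (intro summable_mult summable_ignore_initial_segment summable_geometric) simp
  have "uniformly_convergent_on {0..4} (\<lambda>n v. \<Sum>k<n. norm (weight_factor q (k + j) v - 1))"
    by (intro Weierstrass_m_test'[OF _ sm]) (use weight_factor_bound[OF q] in simp)
  then have "uniformly_convergent_on {0..4} (\<lambda>n v. \<Prod>k<n. weight_factor q (k + j) v)"
    by (intro uniformly_convergent_on_prod') (auto simp: weight_factor_def intro!: continuous_intros)
  then have ul: "uniform_limit {0..4} (\<lambda>n v. \<Prod>k<n. weight_factor q (k + j) v)
      (\<lambda>v. lim (\<lambda>n. \<Prod>k<n. weight_factor q (k + j) v)) sequentially"
    by (simp add: uniformly_convergent_uniform_limit_iff)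
  have "lim (\<lambda>n. \<Prod>k<n. weight_factor q (k + j) v) = (\<Prod>k. weight_factor q (k + j) v)" if "v \<in> {0..4}" for v
    by (intro limI convergent_prod_LIMSEQ_lessThan convergent_prod_weight_factor q that)
  then show ?thesis using ul by (subst uniform_limit_cong') auto
qed

lemma continuous_on_prodinf_weight_factor:
  assumes q: "\<bar>q\<bar> < 1"
  shows "continuous_on {0..4} (\<lambda>v. \<Prod>k. weight_factor q (k + j) v)"
  by (rule uniform_limit_theorem[OF _ uniform_limit_weight_factor[OF q]])
    (auto simp: weight_factor_def intro!: continuous_intros always_eventually)

text \<open>The factor with \<open>k = 0\<close> is the square of the root in the denominator, so
  the endpoint singularity is removable and continuity becomes visible. At the endpoints both sides
  are 0, the left one by the convention for division by zero.\<close>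

lemma f_N_eq:
  assumes q: "\<bar>q\<bar> < 1" and x: "(1 - q) * x\<^sup>2 \<in> {0..4}"
  shows "f_N q x = sqrt (1 - q) * qpoch_inf q q / (2 * pi) * sqrt (4 - (1 - q) * x\<^sup>2) *
    (\<Prod>k. weight_factor q (k + 1) ((1 - q) * x\<^sup>2))"
proof (cases "(1 - q) * x\<^sup>2 = 4")
  case True
  then show ?thesis by (simp add: f_N_def)
next
  case False
  define v where "v = (1 - q) * x\<^sup>2"
  have v: "v \<in> {0..4}" "v < 4" using x False by (auto simp: v_def)
  have c: "convergent_prod (\<lambda>k. weight_factor q k v)" using convergent_prod_weight_factor[OF q v(1), of 0] by simp
  have "weight_factor q 0 v \<noteq> 0" using v by (simp add: weight_factor_def)
  then have "(\<Prod>k. weight_factor q k v) = weight_factor q 0 v * (\<Prod>k. weight_factor q (Suc k) v)"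
    using prodinf_split_head[OF c] by simp
  also have "weight_factor q 0 v = sqrt (4 - v) * sqrt (4 - v)" using v by (simp add: weight_factor_def)
  finally have split: "(\<Prod>k. weight_factor q k v) = sqrt (4 - v) * sqrt (4 - v) * (\<Prod>k. weight_factor q (Suc k) v)" .
  have cancel: "a \<noteq> 0 \<Longrightarrow> a * a * p / a = a * p" for a p :: real by simp
  have "(\<Prod>k. weight_factor q k v) / sqrt (4 - v) = sqrt (4 - v) * (\<Prod>k. weight_factor q (Suc k) v)"
    unfolding split by (rule cancel) (use v in simp)
  then show ?thesis
    by (simp add: f_N_def weight_factor_def v_def divide_simps mult_ac)
qed

lemma S_scaled_sq:
  assumes q: "\<bar>q\<bar> < 1" and x: "x \<in> S q"
  shows "(1 - q) * x\<^sup>2 \<in> {0..4}"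
proof -
  obtain \<theta> where x: "x = 2 * cos \<theta> / sqrt (1 - q)" using cos_param[OF q x] by blast
  have "(1 - q) * x\<^sup>2 = 4 * (cos \<theta>)\<^sup>2"
    using q by (simp add: x power_divide power_mult_distrib)
  moreover have "(cos \<theta>)\<^sup>2 \<le> 1" by (simp add: abs_square_le_1)
  ultimately show ?thesis by simp
qed

lemma continuous_on_f_N:
  assumes q: "\<bar>q\<bar> < 1"
  shows "continuous_on (S q) (f_N q)"
proof -
  have "continuous_on (S q) (\<lambda>x. \<Prod>k. weight_factor q (k + 1) ((1 - q) * x\<^sup>2))"
    by (rule continuous_on_compose2[OF continuous_on_prodinf_weight_factor[OF q]])
      (use S_scaled_sq[OF q] in \<open>auto intro!: continuous_intros\<close>)
  then have "continuous_on (S q) (\<lambda>x. sqrt (1 - q) * qpoch_inf q q / (2 * pi) * sqrt (4 - (1 - q) * x\<^sup>2) *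
    (\<Prod>k. weight_factor q (k + 1) ((1 - q) * x\<^sup>2)))"
    by (intro continuous_intros)
  then show ?thesis
    by (subst continuous_on_cong[OF refl f_N_eq[OF q S_scaled_sq[OF q]]])
qed

section \<open>Moments against the truncated weight\<close>

definition weight_prod :: "real \<Rightarrow> nat \<Rightarrow> real \<Rightarrow> real" where
  "weight_prod q N \<theta> = (\<Prod>k<N. weight_factor q k ((2 * cos \<theta>)\<^sup>2))"

lemma four_cos_sq: "(2 * cos (\<theta>::real))\<^sup>2 \<in> {0..4}"
  by (simp add: power_mult_distrib abs_square_le_1)

lemma uniform_limit_weight_prod:
  assumes q: "\<bar>q\<bar> < 1"
  shows "uniform_limit T (weight_prod q) (\<lambda>\<theta>. \<Prod>k. weight_factor q k ((2 * cos \<theta>)\<^sup>2)) sequentially"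
proof (rule uniform_limitI)
  fix e :: real assume "e > 0"
  then have "\<forall>\<^sub>F n in sequentially. \<forall>v\<in>{0..4}. dist (\<Prod>k<n. weight_factor q (k + 0) v) (\<Prod>k. weight_factor q (k + 0) v) < e"
    by (rule uniform_limitD[OF uniform_limit_weight_factor[OF q]])
  then show "\<forall>\<^sub>F n in sequentially. \<forall>\<theta>\<in>T. dist (weight_prod q n \<theta>) (\<Prod>k. weight_factor q k ((2 * cos \<theta>)\<^sup>2)) < e"
    by (rule eventually_mono) (simp only: weight_prod_def add_0_right, use four_cos_sq in blast)
qed

text \<open>On \<open>{-pi..0}\<close> the cosine increases from -1 to 1, so the later substitution
  onto \<open>S q\<close> preserves orientation.\<close>

definition weight_int :: "real \<Rightarrow> nat \<Rightarrow> nat \<Rightarrow> real" where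
  "weight_int q N n = integral {-pi..0} (\<lambda>\<theta>. cos_sum q n \<theta> * weight_prod q N \<theta>)"

lemma continuous_on_cos_sum: "continuous_on T (cos_sum q n)"
  unfolding cos_sum_def divide_inverse by (auto intro!: continuous_intros)

lemma continuous_on_weight_prod: "continuous_on T (weight_prod q n)"
  unfolding weight_prod_def weight_factor_def by (auto intro!: continuous_intros)

lemma cos_sum_rec':
  assumes q: "\<bar>q\<bar> < 1"
  shows "2 * cos \<theta> * cos_sum q n \<theta> = qnum q (Suc n) * cos_sum q (Suc n) \<theta>
     + (1 - q) * (if n = 0 then 0 else cos_sum q (n - 1) \<theta>)"
proof (cases n)
  case 0
  then show ?thesis by (simp add: cos_sum_def qfact_Suc)
next
  case (Suc m)
  then show ?thesis using cos_sum_rec[OF q, of \<theta> m] by simp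
qed

lemma cos_sum_sq:
  assumes q: "\<bar>q\<bar> < 1"
  shows "(2 * cos \<theta>)\<^sup>2 * cos_sum q n \<theta> = qnum q (Suc n) * qnum q (Suc (Suc n)) * cos_sum q (Suc (Suc n)) \<theta>
     + (1 - q) * (qnum q (Suc n) + qnum q n) * cos_sum q n \<theta>
     + (1 - q)\<^sup>2 * (if n < 2 then 0 else cos_sum q (n - 2) \<theta>)"
proof -
  let ?x = "2 * cos \<theta>"
  have "?x\<^sup>2 * cos_sum q n \<theta> = ?x * (?x * cos_sum q n \<theta>)" by (simp add: power2_eq_square)
  also have "\<dots> = qnum q (Suc n) * (?x * cos_sum q (Suc n) \<theta>)
     + (1 - q) * (if n = 0 then 0 else ?x * cos_sum q (n - 1) \<theta>)"
    unfolding cos_sum_rec'[OF q, of _ n] by (simp add: algebra_simps)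
  also have "?x * cos_sum q (Suc n) \<theta> = qnum q (Suc (Suc n)) * cos_sum q (Suc (Suc n)) \<theta>
     + (1 - q) * cos_sum q n \<theta>" using cos_sum_rec'[OF q, of _ "Suc n"] by simp
  also have "(if n = 0 then 0 else ?x * cos_sum q (n - 1) \<theta>) =
     qnum q n * cos_sum q n \<theta> + (1 - q) * (if n < 2 then 0 else cos_sum q (n - 2) \<theta>)"
    using cos_sum_rec'[OF q, of _ "n - 1"] by (cases n) (auto simp: numeral_2_eq_2)
  finally show ?thesis by (simp add: algebra_simps power2_eq_square)
qed

lemma weight_int_Suc:
  assumes q: "\<bar>q\<bar> < 1"
  shows "weight_int q (Suc N) n = (1 + q ^ N)\<^sup>2 * weight_int q N n
     - q ^ N * (qnum q (Suc n) * qnum q (Suc (Suc n)) * weight_int q N (Suc (Suc n))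
     + (1 - q) * (qnum q (Suc n) + qnum q n) * weight_int q N n
     + (1 - q)\<^sup>2 * (if n < 2 then 0 else weight_int q N (n - 2)))"
proof -
  have I: "((\<lambda>\<theta>. cos_sum q n \<theta> * weight_prod q N \<theta>) has_integral weight_int q N n) {-pi..0}" for n
    unfolding weight_int_def
    by (intro integrable_integral integrable_continuous_real continuous_on_mult continuous_on_cos_sum continuous_on_weight_prod)
  have I': "((\<lambda>\<theta>. (if n < 2 then 0 else cos_sum q (n - 2) \<theta>) * weight_prod q N \<theta>) has_integral
      (if n < 2 then 0 else weight_int q N (n - 2))) {-pi..0}"
    using I by (cases "n < 2") auto
  have eq: "cos_sum q n \<theta> * weight_prod q (Suc N) \<theta> = (1 + q ^ N)\<^sup>2 * (cos_sum q n \<theta> * weight_prod q N \<theta>)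
     - q ^ N * (qnum q (Suc n) * qnum q (Suc (Suc n)) * (cos_sum q (Suc (Suc n)) \<theta> * weight_prod q N \<theta>)
     + (1 - q) * (qnum q (Suc n) + qnum q n) * (cos_sum q n \<theta> * weight_prod q N \<theta>)
     + (1 - q)\<^sup>2 * ((if n < 2 then 0 else cos_sum q (n - 2) \<theta>) * weight_prod q N \<theta>))" for \<theta>
  proof -
    have "cos_sum q n \<theta> * weight_prod q (Suc N) \<theta>
      = ((1 + q ^ N)\<^sup>2 * cos_sum q n \<theta> - q ^ N * ((2 * cos \<theta>)\<^sup>2 * cos_sum q n \<theta>)) * weight_prod q N \<theta>"
      by (simp add: weight_prod_def weight_factor_def algebra_simps)
    then show ?thesis unfolding cos_sum_sq[OF q] by (simp only: ring_distribs mult_ac)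
  qed
  show ?thesis unfolding weight_int_def[of q "Suc N"] eq
    by (intro integral_unique has_integral_diff has_integral_add has_integral_mult_right I I')
qed

text \<open>Up to normalization, this is the connection coefficient from the \<open>q\<close>-Hermite polynomials
  to the Rogers polynomials with parameter \<open>q\<^sup>N\<close>, whose weight is the truncated product.\<close>

definition weight_val :: "real \<Rightarrow> nat \<Rightarrow> nat \<Rightarrow> real" where
  "weight_val q N m = 2 * pi * (1 - q) ^ (2 * m) * qpoch q q (2 * N) * q ^ (N * m) /
     (qpoch q q m * qpoch q q N * qpoch q q (N + m) * (1 + q ^ N))"

lemma one_plus_power_pos:
  fixes q :: real assumes "\<bar>q\<bar> < 1" shows "1 + q ^ N > 0"
proof (cases N)
  case (Suc n)
  have "\<bar>q\<bar> ^ N < 1"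
    using assms Suc by (simp only: power_less_one_iff abs_ge_zero) simp
  then show ?thesis by (simp add: power_abs[symmetric] abs_less_iff)
qed simp

lemma one_minus_power_pos:
  fixes q :: real assumes "\<bar>q\<bar> < 1" shows "1 - q * q ^ N > 0"
  using qpoch_factor_pos[OF assms assms] .

text \<open>A quotient of neighbours, stated without dividing by \<open>weight_val\<close>, which
  can vanish (for instance at \<open>q = 0\<close> with \<open>N\<close> and \<open>m\<close>
  positive).\<close>

lemma weight_val_Suc_right:
  assumes q: "\<bar>q\<bar> < 1"
  shows "weight_val q N (Suc m) * ((1 - q * q ^ m) * (1 - q * (q ^ N * q ^ m))) = weight_val q N m * ((1 - q)\<^sup>2 * q ^ N)"
proof -
  have nz: "qpoch q q k \<noteq> 0" "1 + q ^ k \<noteq> 0" "1 - q * q ^ k \<noteq> 0" for k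
    using qpoch_pos[OF q q, of k] one_plus_power_pos[OF q, of k] one_minus_power_pos[OF q, of k] by auto
  have a: "1 - q * (q ^ N * q ^ m) \<noteq> 0" using nz(3)[of "N + m"] by (simp add: power_add)
  have num: "2 * pi * (1 - q) ^ (2 * Suc m) * qpoch q q (2 * N) * q ^ (N * Suc m)
    = (2 * pi * (1 - q) ^ (2 * m) * qpoch q q (2 * N) * q ^ (N * m)) * ((1 - q)\<^sup>2 * q ^ N)"
    by (simp add: power_add power2_eq_square)
  have den: "qpoch q q (Suc m) * qpoch q q N * qpoch q q (N + Suc m) * (1 + q ^ N)
    = (qpoch q q m * qpoch q q N * qpoch q q (N + m) * (1 + q ^ N)) * ((1 - q * q ^ m) * (1 - q * (q ^ N * q ^ m)))"
    by (simp add: qpoch_Suc power_add)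
  show ?thesis unfolding weight_val_def num den using nz(3)[of m] a by simp
qed

lemma weight_val_Suc_left:
  assumes q: "\<bar>q\<bar> < 1"
  shows "weight_val q (Suc N) m * (1 - q * (q ^ N * q ^ m)) =
    weight_val q N m * (q ^ m * (1 + q ^ N) * (1 - q * (q ^ N)\<^sup>2))"
proof -
  have nz: "qpoch q q k \<noteq> 0" "1 + q ^ k \<noteq> 0" "1 - q * q ^ k \<noteq> 0" for k
    using qpoch_pos[OF q q, of k] one_plus_power_pos[OF q, of k] one_minus_power_pos[OF q, of k] by auto
  have a: "1 - q * (q ^ N * q ^ m) \<noteq> 0" using nz(3)[of "N + m"] by (simp add: power_add)
  define D where "D = qpoch q q m * qpoch q q N * qpoch q q (N + m)"
  have D: "D \<noteq> 0" using nz by (simp add: D_def)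
  have num: "2 * pi * (1 - q) ^ (2 * m) * qpoch q q (2 * Suc N) * q ^ (Suc N * m)
    = (2 * pi * (1 - q) ^ (2 * m) * qpoch q q (2 * N) * q ^ (N * m)) *
      (q ^ m * (1 - q * (q ^ N)\<^sup>2) * ((1 - q * q ^ N) * (1 + q * q ^ N)))"
    by (simp add: qpoch_Suc power_add power_mult power2_eq_square power_mult_distrib) (simp add: algebra_simps)
  have den: "qpoch q q m * qpoch q q (Suc N) * qpoch q q (Suc N + m) * (1 + q ^ Suc N)
    = (D * (1 - q * (q ^ N * q ^ m))) * ((1 - q * q ^ N) * (1 + q * q ^ N))"
    by (simp add: D_def qpoch_Suc power_add)
  have nn: "(1 - q * q ^ N) * (1 + q * q ^ N) \<noteq> 0" using nz(3)[of N] nz(2)[of "Suc N"] by simp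
  have den0: "qpoch q q m * qpoch q q N * qpoch q q (N + m) * (1 + q ^ N) = D * (1 + q ^ N)"
    by (simp add: D_def)
  have cancel: "(u * (k * c)) / ((d * e) * c) * e = u / (d * p) * (k * p)"
    if "c \<noteq> 0" "d \<noteq> 0" "e \<noteq> 0" "p \<noteq> 0" for u k c d e p :: real
    using that by (simp add: field_simps)
  show ?thesis unfolding weight_val_def num den den0
    using cancel[OF nn D a nz(2)[of N],
      of "2 * pi * (1 - q) ^ (2 * m) * qpoch q q (2 * N) * q ^ (N * m)" "q ^ m * (1 - q * (q ^ N)\<^sup>2)"]
    by (simp only: mult_ac)
qed

text \<open>All neighbours are multiples of \<open>a = weight_val q N m\<close>. After
  multiplication by the one remaining denominator \<open>1 - q * (Q * M)\<close>, the claim is a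
  polynomial identity in \<open>q\<close>, \<open>Q\<close> and \<open>M\<close>.\<close>

lemma weight_val_rec:
  assumes q: "\<bar>q\<bar> < 1"
  shows "weight_val q (Suc N) m = (1 + q ^ N)\<^sup>2 * weight_val q N m
     - q ^ N * (qnum q (Suc (2 * m)) * qnum q (Suc (Suc (2 * m))) * weight_val q N (Suc m)
     + (1 - q) * (qnum q (Suc (2 * m)) + qnum q (2 * m)) * weight_val q N m
     + (1 - q)\<^sup>2 * (if m = 0 then 0 else weight_val q N (m - 1)))"
proof -
  define Q M where "Q = q ^ N" "M = q ^ m"
  define a where "a = weight_val q N m"
  have nz: "1 - q * M \<noteq> 0" "1 - q * (Q * M) \<noteq> 0" "1 - q \<noteq> 0"
    using one_minus_power_pos[OF q, of m] one_minus_power_pos[OF q, of "N + m"] q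
    by (auto simp: Q_M_def power_add)
  have n0: "(1 - q) * qnum q (2 * m) = 1 - M\<^sup>2" and n1: "(1 - q) * qnum q (Suc (2 * m)) = 1 - q * M\<^sup>2"
    and n2: "(1 - q) * qnum q (Suc (Suc (2 * m))) = 1 - q\<^sup>2 * M\<^sup>2"
    unfolding one_minus_times_qnum Q_M_def by (simp_all add: power_mult power2_eq_square power_mult_distrib)
  have A: "weight_val q N (Suc m) * ((1 - q * M) * (1 - q * (Q * M))) = a * ((1 - q)\<^sup>2 * Q)"
    unfolding a_def Q_M_def by (rule weight_val_Suc_right[OF q])
  have B: "weight_val q (Suc N) m * (1 - q * (Q * M)) = a * (M * (1 + Q) * (1 - q * Q\<^sup>2))"
    unfolding a_def Q_M_def by (rule weight_val_Suc_left[OF q])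
  \<comment> \<open>At \<open>m = 0\<close> the default value 0 agrees with the right side, since
    \<open>M = 1\<close> there.\<close>
  have C: "Q * ((1 - q)\<^sup>2 * (if m = 0 then 0 else weight_val q N (m - 1))) = a * ((1 - M) * (1 - Q * M))"
  proof (cases m)
    case 0
    then show ?thesis by (simp add: Q_M_def)
  next
    case (Suc k)
    then show ?thesis using weight_val_Suc_right[OF q, of N k] by (simp add: a_def Q_M_def mult_ac)
  qed
  \<comment> \<open>The factor \<open>1 - q\<^sup>2 * M\<^sup>2\<close> coming from the second
    q-integer is divisible by \<open>1 - q * M\<close>, which removes one denominator of
    \<open>A\<close>.\<close>
  have A': "qnum q (Suc (2 * m)) * qnum q (Suc (Suc (2 * m))) * weight_val q N (Suc m) * (1 - q * (Q * M))
    = (1 - q * M\<^sup>2) * (1 + q * M) * (a * Q)"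
  proof -
    have "(qnum q (Suc (2 * m)) * qnum q (Suc (Suc (2 * m))) * weight_val q N (Suc m) * (1 - q * (Q * M))) * (1 - q * M)
      = qnum q (Suc (2 * m)) * qnum q (Suc (Suc (2 * m))) * (weight_val q N (Suc m) * ((1 - q * M) * (1 - q * (Q * M))))"
      by (simp only: mult_ac)
    also have "\<dots> = ((1 - q) * qnum q (Suc (2 * m))) * ((1 - q) * qnum q (Suc (Suc (2 * m)))) * (a * Q)"
      unfolding A by (simp add: power2_eq_square mult_ac)
    also have "\<dots> = ((1 - q * M\<^sup>2) * (1 + q * M) * (a * Q)) * (1 - q * M)"
      unfolding n1 n2 by (simp add: power2_eq_square algebra_simps)
    finally show ?thesis using nz(1) by simp
  qed
  define U where "U = qnum q (Suc (2 * m)) * qnum q (Suc (Suc (2 * m))) * weight_val q N (Suc m)"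
  define V where "V = (1 - q)\<^sup>2 * (if m = 0 then 0 else weight_val q N (m - 1))"
  have mid: "(1 - q) * (qnum q (Suc (2 * m)) + qnum q (2 * m)) = 2 - q * M\<^sup>2 - M\<^sup>2"
    using n0 n1 by (simp add: distrib_left)
  have "((1 + Q)\<^sup>2 * a - Q * (U + (2 - q * M\<^sup>2 - M\<^sup>2) * a + V)) * (1 - q * (Q * M))
    = ((1 + Q)\<^sup>2 * a - Q * ((2 - q * M\<^sup>2 - M\<^sup>2) * a)) * (1 - q * (Q * M))
      - Q * (U * (1 - q * (Q * M))) - (Q * V) * (1 - q * (Q * M))"
    by (simp add: algebra_simps)
  also have "\<dots> = weight_val q (Suc N) m * (1 - q * (Q * M))"
    unfolding B C[folded V_def] A'[folded U_def] by (simp add: power2_eq_square algebra_simps)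
  finally have "(1 + Q)\<^sup>2 * a - Q * (U + (2 - q * M\<^sup>2 - M\<^sup>2) * a + V) = weight_val q (Suc N) m"
    using nz(2) by simp
  then show ?thesis unfolding mid U_def V_def a_def Q_M_def by simp
qed

lemma integral_cos_multiple:
  assumes "k \<noteq> (0::int)"
  shows "((\<lambda>\<theta>. cos (of_int k * \<theta>)) has_integral (0::real)) {-pi..0}"
proof -
  have "((\<lambda>\<theta>. cos (of_int k * \<theta>)) has_integral
     (sin (of_int k * 0) / of_int k - sin (of_int k * (- pi)) / of_int k)) {-pi..0}"
    using assms by (intro fundamental_theorem_of_calculus)
      (auto simp: has_real_derivative_iff_has_vector_derivative[symmetric] intro!: derivative_eq_intros)
  then show ?thesis using sin_integer_2pi sin_int_times_real by (simp add: sin_times_pi_eq_0 mult.commute)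
qed

text \<open>Without any weight factor only the constant cosine, \<open>i = n - i\<close>, has a
  nonzero integral; it exists exactly for even \<open>n\<close>.\<close>

lemma weight_int_0:
  assumes q: "\<bar>q\<bar> < 1"
  shows "weight_int q 0 (2 * m) = weight_val q 0 m" and "weight_int q 0 (Suc (2 * m)) = 0"
proof -
  have c: "((\<lambda>\<theta>. cos ((real i - real j) * \<theta>)) has_integral (if i = j then pi else 0)) {-pi..0}" for i j
    using integral_cos_multiple[of "int i - int j"] has_integral_const_real[of "1::real" "-pi" 0] by auto
  have h: "weight_int q 0 n = (\<Sum>i\<le>n. (if i = n - i then pi else 0) / (qfact q i * qfact q (n - i)))" for n
    unfolding weight_int_def weight_prod_def cos_sum_def lessThan_0 prod.empty mult_1_right
    by (intro integral_unique has_integral_sum has_integral_divide c) simp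
  have "weight_int q 0 (2 * m) = (\<Sum>i\<le>2 * m. if i = m then pi / (qfact q m * qfact q m) else 0)"
    unfolding h by (intro sum.cong refl) auto
  also have "\<dots> = pi / (qfact q m * qfact q m)" by (subst sum.delta) auto
  also have "\<dots> = weight_val q 0 m"
  proof -
    have "1 - q \<noteq> 0" using q by auto
    then have "(1 - q) ^ m \<noteq> 0" by simp
    then show ?thesis
      by (simp add: weight_val_def qpoch_qfact power_mult power2_eq_square power_mult_distrib)
  qed
  finally show "weight_int q 0 (2 * m) = weight_val q 0 m" .
  show "weight_int q 0 (Suc (2 * m)) = 0"
    unfolding h by (intro sum.neutral) (auto, presburger)
qed

lemma weight_int_eq:
  assumes q: "\<bar>q\<bar> < 1"
  shows "weight_int q N (2 * m) = weight_val q N m" and "weight_int q N (Suc (2 * m)) = 0"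
proof (induction N arbitrary: m)
  case 0
  { case 1 show ?case by (rule weight_int_0[OF q]) }
  { case 2 show ?case by (rule weight_int_0[OF q]) }
next
  case (Suc N)
  { case 1
    have "(if 2 * m < 2 then 0 else weight_int q N (2 * m - 2)) = (if m = 0 then 0 else weight_val q N (m - 1))"
      using Suc(1)[of "m - 1"] by (cases m) auto
    moreover have "weight_int q N (Suc (Suc (2 * m))) = weight_val q N (Suc m)"
      using Suc(1)[of "Suc m"] by simp
    ultimately show ?case
      unfolding weight_int_Suc[OF q] weight_val_rec[OF q, of N m] by (simp add: Suc(1)) }
  { case 2
    have "(if Suc (2 * m) < 2 then 0 else weight_int q N (Suc (2 * m) - 2)) = 0"
      using Suc(2)[of "m - 1"] by (cases m) auto
    moreover have "weight_int q N (Suc (Suc (Suc (2 * m)))) = 0"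
      using Suc(2)[of "Suc m"] by simp
    ultimately show ?case
      unfolding weight_int_Suc[OF q] by (simp add: Suc(2)) }
qed

text \<open>For \<open>m > 0\<close> the factor \<open>q ^ (N * m)\<close> of the closed form tends
  to 0, while every other factor has a finite limit and the denominator a nonzero one.\<close>

lemma weight_int_LIMSEQ:
  assumes q: "\<bar>q\<bar> < 1"
  shows "(\<lambda>N. weight_int q N n) \<longlonglongrightarrow> (if n = 0 then 2 * pi / qpoch_inf q q else 0)"
proof (cases "even n")
  case True
  then obtain m where m: "n = 2 * m" by blast
  have Q: "qpoch_inf q q \<noteq> 0" using qpoch_inf_pos[OF q q] by simp
  have nz: "qpoch q q m \<noteq> 0" using qpoch_pos[OF q q, of m] by simp
  have l: "(\<lambda>N. qpoch q q N) \<longlonglongrightarrow> qpoch_inf q q" by (rule qpoch_LIMSEQ[OF q])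
  have l2: "(\<lambda>N. qpoch q q (2 * N)) \<longlonglongrightarrow> qpoch_inf q q"
    using LIMSEQ_subseq_LIMSEQ[OF l, of "\<lambda>N. 2 * N"] by (simp add: strict_mono_def o_def)
  have l3: "(\<lambda>N. qpoch q q (N + m)) \<longlonglongrightarrow> qpoch_inf q q"
    using l by (rule LIMSEQ_ignore_initial_segment)
  have q0: "(\<lambda>N. q ^ N) \<longlonglongrightarrow> 0" using q by (intro LIMSEQ_power_zero) simp
  have l4: "(\<lambda>N. q ^ (N * m)) \<longlonglongrightarrow> (if m = 0 then 1 else 0)"
  proof (cases "m = 0")
    case False
    then show ?thesis using tendsto_power[OF q0, of m] by (simp add: power_mult power_0_left)
  qed simp
  have "(\<lambda>N. weight_val q N m) \<longlonglongrightarrow> 2 * pi * (1 - q) ^ (2 * m) * qpoch_inf q q * (if m = 0 then 1 else 0) /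
     (qpoch q q m * qpoch_inf q q * qpoch_inf q q * (1 + 0))"
    unfolding weight_val_def using Q nz by (intro tendsto_intros l l2 l3 l4 q0) auto
  then show ?thesis using Q unfolding m weight_int_eq[OF q] by (cases "m = 0") auto
next
  case False
  then obtain m where "n = Suc (2 * m)" by (metis oddE Suc_eq_plus1)
  then show ?thesis by (simp add: weight_int_eq[OF q])
qed

section \<open>Passage from the truncated products to \<open>f_N\<close>\<close>

lemma integral_cos_sum_weight:
  assumes q: "\<bar>q\<bar> < 1"
  shows "((\<lambda>\<theta>. cos_sum q n \<theta> * (\<Prod>k. weight_factor q k ((2 * cos \<theta>)\<^sup>2))) has_integral
     (if n = 0 then 2 * pi / qpoch_inf q q else 0)) {-pi..0}"
proof -
  have "bounded (cos_sum q n ` {-pi..0})"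
    by (intro compact_imp_bounded compact_continuous_image continuous_on_cos_sum compact_Icc)
  then have ul: "uniform_limit {-pi..0} (\<lambda>N \<theta>. cos_sum q n \<theta> * weight_prod q N \<theta>)
    (\<lambda>\<theta>. cos_sum q n \<theta> * (\<Prod>k. weight_factor q k ((2 * cos \<theta>)\<^sup>2))) sequentially"
  proof (intro uniform_lim_mult uniform_limit_const uniform_limit_weight_prod q)
    have "continuous_on {-pi..0} (\<lambda>\<theta>. \<Prod>k. weight_factor q k ((2 * cos \<theta>)\<^sup>2))"
      by (rule uniform_limit_theorem[OF _ uniform_limit_weight_prod[OF q]])
        (auto intro!: continuous_on_weight_prod always_eventually)
    then show "bounded ((\<lambda>\<theta>. \<Prod>k. weight_factor q k ((2 * cos \<theta>)\<^sup>2)) ` {-pi..0})"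
      by (intro compact_imp_bounded compact_continuous_image compact_Icc)
  qed simp_all
  obtain I J where IJ: "\<And>N. ((\<lambda>\<theta>. cos_sum q n \<theta> * weight_prod q N \<theta>) has_integral I N) {-pi..0}"
    "((\<lambda>\<theta>. cos_sum q n \<theta> * (\<Prod>k. weight_factor q k ((2 * cos \<theta>)\<^sup>2))) has_integral J) {-pi..0}" "I \<longlonglongrightarrow> J"
    by (rule uniform_limit_integral[OF ul])
      (auto intro!: continuous_on_mult continuous_on_cos_sum continuous_on_weight_prod)
  have "I = (\<lambda>N. weight_int q N n)" by (intro ext) (simp add: weight_int_def integral_unique[OF IJ(1)])
  then have "J = (if n = 0 then 2 * pi / qpoch_inf q q else 0)"
    using IJ(3) weight_int_LIMSEQ[OF q] LIMSEQ_unique by blast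
  then show ?thesis using IJ(2) by simp
qed

text \<open>The derivative of the substitution cancels the square root, which is
  \<open>- 2 * sin \<theta>\<close> because the sine is nonpositive on this interval. Where the sine
  vanishes, the right side is 0 through its factor with \<open>k = 0\<close>.\<close>

lemma f_N_cos:
  assumes q: "\<bar>q\<bar> < 1" and \<theta>: "\<theta> \<in> {-pi..0}"
  shows "- (2 * sin \<theta>) / sqrt (1 - q) * f_N q (2 * cos \<theta> / sqrt (1 - q))
    = qpoch_inf q q / (2 * pi) * (\<Prod>k. weight_factor q k ((2 * cos \<theta>)\<^sup>2))"
proof -
  have s: "sqrt (1 - q) > 0" "(sqrt (1 - q))\<^sup>2 = 1 - q" "1 - q > 0" using sqrt_one_minus_q[OF q] q by auto
  have x: "(1 - q) * (2 * cos \<theta> / sqrt (1 - q))\<^sup>2 = (2 * cos \<theta>)\<^sup>2"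
    using s by (simp add: power_divide)
  have sin: "sin \<theta> \<le> 0" using sin_ge_zero[of "- \<theta>"] \<theta> by simp
  have "4 - (2 * cos \<theta>)\<^sup>2 = (- 2 * sin \<theta>)\<^sup>2"
    by (simp add: power_mult_distrib sin_squared_eq)
  then have sq: "sqrt (4 - (2 * cos \<theta>)\<^sup>2) = - 2 * sin \<theta>"
    using sin by (simp only: real_sqrt_abs)
  have f: "f_N q (2 * cos \<theta> / sqrt (1 - q)) = sqrt (1 - q) * qpoch_inf q q / (2 * pi * (- 2 * sin \<theta>)) *
     (\<Prod>k. weight_factor q k ((2 * cos \<theta>)\<^sup>2))"
    unfolding f_N_def x sq weight_factor_def ..
  show ?thesis
  proof (cases "sin \<theta> = 0")
    case True
    then have "(2 * cos \<theta>)\<^sup>2 = 4" using sin_cos_squared_add2[of \<theta>] by (simp add: power_mult_distrib)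
    then have "weight_factor q 0 ((2 * cos \<theta>)\<^sup>2) = 0" by (simp add: weight_factor_def)
    moreover have "convergent_prod (\<lambda>k. weight_factor q k ((2 * cos \<theta>)\<^sup>2))"
      using convergent_prod_weight_factor[OF q four_cos_sq, of 0] by simp
    ultimately have "(\<Prod>k. weight_factor q k ((2 * cos \<theta>)\<^sup>2)) = 0"
      using has_prod_eq_0_iff[OF convergent_prod_has_prod] by fastforce
    then show ?thesis using True by simp
  next
    case False
    then show ?thesis unfolding f using s(1) by (simp add: field_simps)
  qed
qed

definition hermite_int :: "real \<Rightarrow> (real \<Rightarrow> real) \<Rightarrow> real" where
  "hermite_int q g = integral (S q) (\<lambda>x. g x * f_N q x)"

lemma continuous_on_qHermite: "continuous_on T (qHermite q n)"
  by (induction q n x\<equiv>"0::real" rule: qHermite.induct) (auto intro!: continuous_intros)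

text \<open>Substituting \<open>x = 2 * cos \<theta> / sqrt (1 - q)\<close> reduces this to
  \<open>integral_cos_sum_weight\<close>; at \<open>n = 0\<close> the constant in \<open>f_N\<close>
  cancels \<open>2 * pi / qpoch_inf q q\<close>, so \<open>f_N\<close> has total mass 1.\<close>

lemma hermite_int_qHermite:
  assumes q: "\<bar>q\<bar> < 1"
  shows "hermite_int q (qHermite q n) = (if n = 0 then 1 else 0)"
proof -
  let ?s = "sqrt (1 - q)"
  let ?g = "\<lambda>\<theta>. 2 * cos \<theta> / ?s"
  have s: "?s > 0" "1 - q > 0" using q by auto
  have cont: "continuous_on {-2 / ?s..2 / ?s} (\<lambda>x. qHermite q n x * f_N q x)"
    using continuous_on_mult[OF continuous_on_qHermite continuous_on_f_N[OF q]] by (simp add: S_def)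
  have "((\<lambda>\<theta>. (- (2 * sin \<theta>) / ?s) *\<^sub>R (qHermite q n (?g \<theta>) * f_N q (?g \<theta>))) has_integral
     (integral {?g (-pi)..?g 0} (\<lambda>x. qHermite q n x * f_N q x))) {-pi..0}"
  proof (rule has_integral_substitution[OF _ _ _ cont])
    show "?g ` {-pi..0} \<subseteq> {-2 / ?s..2 / ?s}"
    proof (intro image_subsetI)
      fix \<theta> :: real
      have "-2 \<le> 2 * cos \<theta>" "2 * cos \<theta> \<le> 2" using cos_ge_minus_one[of \<theta>] cos_le_one[of \<theta>] by linarith+
      then have "-2 / ?s \<le> ?g \<theta>" "?g \<theta> \<le> 2 / ?s" using s by (intro divide_right_mono; simp)+
      then show "?g \<theta> \<in> {-2 / ?s..2 / ?s}" by simp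
    qed
    show "(?g has_field_derivative - (2 * sin x) / ?s) (at x within {- pi..0})" for x
      using DERIV_cmult[OF DERIV_subset[OF DERIV_cos[of x]], of "{-pi..0}" "2 / ?s"] by simp
  qed (use s in auto)
  moreover have "integral {?g (-pi)..?g 0} (\<lambda>x. qHermite q n x * f_N q x) = hermite_int q (qHermite q n)"
    by (simp add: hermite_int_def S_def)
  ultimately have 1: "((\<lambda>\<theta>. (- (2 * sin \<theta>) / ?s) * (qHermite q n (?g \<theta>) * f_N q (?g \<theta>))) has_integral
    hermite_int q (qHermite q n)) {-pi..0}" by simp
  have 2: "((\<lambda>\<theta>. qfact q n / ?s ^ n * (qpoch_inf q q / (2 * pi)) * (cos_sum q n \<theta> * (\<Prod>k. weight_factor q k ((2 * cos \<theta>)\<^sup>2)))) has_integral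
     qfact q n / ?s ^ n * (qpoch_inf q q / (2 * pi)) * (if n = 0 then 2 * pi / qpoch_inf q q else 0)) {-pi..0}"
    by (intro has_integral_mult_right integral_cos_sum_weight q)
  have "hermite_int q (qHermite q n) = qfact q n / ?s ^ n * (qpoch_inf q q / (2 * pi)) * (if n = 0 then 2 * pi / qpoch_inf q q else 0)"
  proof (rule has_integral_unique[OF has_integral_eq[OF _ 1] 2])
    fix \<theta> assume t: "\<theta> \<in> {-pi..0}"
    have h: "qHermite q n (?g \<theta>) = qfact q n / ?s ^ n * cos_sum q n \<theta>"
      using qHermite_cos[OF q, of n \<theta>] s by (simp add: field_simps)
    have "(- (2 * sin \<theta>) / ?s) * (qHermite q n (?g \<theta>) * f_N q (?g \<theta>))
      = qHermite q n (?g \<theta>) * ((- (2 * sin \<theta>) / ?s) * f_N q (?g \<theta>))" by (simp only: mult_ac)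
    also have "\<dots> = qfact q n / ?s ^ n * (qpoch_inf q q / (2 * pi)) * (cos_sum q n \<theta> * (\<Prod>k. weight_factor q k ((2 * cos \<theta>)\<^sup>2)))"
      unfolding f_N_cos[OF q t] h by (simp only: mult_ac)
    finally show "(- (2 * sin \<theta>) / ?s) * (qHermite q n (?g \<theta>) * f_N q (?g \<theta>))
      = qfact q n / ?s ^ n * (qpoch_inf q q / (2 * pi)) * (cos_sum q n \<theta> * (\<Prod>k. weight_factor q k ((2 * cos \<theta>)\<^sup>2)))" .
  qed
  then show ?thesis using qpoch_inf_pos[OF q q] by auto
qed

section \<open>Linearization and conditional moments\<close>

lemma compact_S: "compact (S q)"
  by (simp add: S_def)

lemma hermite_int_has_integral:
  assumes q: "\<bar>q\<bar> < 1" and g: "continuous_on (S q) g"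
  shows "((\<lambda>x. g x * f_N q x) has_integral hermite_int q g) (S q)"
proof -
  have "continuous_on (S q) (\<lambda>x. g x * f_N q x)"
    by (intro continuous_on_mult g continuous_on_f_N q)
  then show ?thesis
    unfolding hermite_int_def S_def by (intro integrable_integral integrable_continuous_real)
qed

lemma hermite_int_sum:
  assumes q: "\<bar>q\<bar> < 1" and fin: "finite A" and g: "\<And>k. k \<in> A \<Longrightarrow> continuous_on (S q) (g k)"
  shows "hermite_int q (\<lambda>x. \<Sum>k\<in>A. c k * g k x) = (\<Sum>k\<in>A. c k * hermite_int q (g k))"
proof -
  have "((\<lambda>x. \<Sum>k\<in>A. c k * (g k x * f_N q x)) has_integral (\<Sum>k\<in>A. c k * hermite_int q (g k))) (S q)"
    by (intro has_integral_sum has_integral_mult_right hermite_int_has_integral q fin g)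
  then show ?thesis
    unfolding hermite_int_def[of q "\<lambda>x. \<Sum>k\<in>A. c k * g k x"]
    by (intro integral_unique) (simp add: sum_distrib_left mult_ac)
qed

lemma uniform_limit_kernel:
  assumes q: "\<bar>q\<bar> < 1" and t: "\<bar>t\<bar> < 1" and y: "y \<in> S q"
  shows "uniform_limit (S q) (\<lambda>n x. \<Sum>m<n. t ^ m / qfact q m * qHermite q m x * qHermite q m y)
    (\<lambda>x. mehler q t x y 0 0) sequentially"
proof -
  obtain K where K: "K > 0" "\<And>m i j t y z. y \<in> S q \<Longrightarrow> z \<in> S q \<Longrightarrow>
     \<bar>t ^ m / qfact q m * qHermite q (m + i) y * qHermite q (m + j) z\<bar>
       \<le> K / sqrt (1 - q) ^ (i + j) * (\<bar>t\<bar> ^ m * ((real m + (real i + 1)) * (real m + (real j + 1))))"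
    using kernel_majorant[OF q] by blast
  have "norm (t ^ m / qfact q m * qHermite q m x * qHermite q m y)
    \<le> K / sqrt (1 - q) ^ (0 + 0) * (\<bar>t\<bar> ^ m * ((real m + (real 0 + 1)) * (real m + (real 0 + 1))))"
    if "x \<in> S q" for m x
    using K(2)[OF that y, of t m 0 0] by (simp only: real_norm_def add_0_right)
  then have "uniform_limit (S q) (\<lambda>n x. \<Sum>m<n. t ^ m / qfact q m * qHermite q m x * qHermite q m y)
    (\<lambda>x. \<Sum>m. t ^ m / qfact q m * qHermite q m x * qHermite q m y) sequentially"
    by (rule Weierstrass_m_test[OF _ summable_mult[OF summable_poly_geometric[OF t]]])
  then show ?thesis by (simp add: mehler_def)
qed

lemma continuous_on_kernel:
  assumes q: "\<bar>q\<bar> < 1" and t: "\<bar>t\<bar> < 1" and y: "y \<in> S q"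
  shows "continuous_on (S q) (\<lambda>x. mehler q t x y 0 0)"
  by (rule uniform_limit_theorem[OF _ uniform_limit_kernel[OF assms]])
    (auto intro!: always_eventually continuous_intros continuous_on_qHermite simp: qfact_neq_0[OF q])

text \<open>The kernel series converges uniformly on the compact \<open>S q\<close>, and the
  continuous factor \<open>g x * f_N q x\<close> is bounded there, so integration may be done term
  by term.\<close>

lemma hermite_int_kernel_sums:
  assumes q: "\<bar>q\<bar> < 1" and t: "\<bar>t\<bar> < 1" and y: "y \<in> S q" and g: "continuous_on (S q) g"
  shows "(\<lambda>m. t ^ m / qfact q m * qHermite q m y * hermite_int q (\<lambda>x. g x * qHermite q m x))
    sums hermite_int q (\<lambda>x. g x * mehler q t x y 0 0)"
proof -
  define p where "p n x = (\<Sum>m<n. t ^ m / qfact q m * qHermite q m x * qHermite q m y)" for n x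
  have gf: "continuous_on (S q) (\<lambda>x. g x * f_N q x)"
    by (intro continuous_on_mult g continuous_on_f_N q)
  have p: "continuous_on (S q) (p n)" for n
    unfolding p_def by (intro continuous_intros continuous_on_qHermite)
  have "uniform_limit (S q) (\<lambda>n x. (g x * f_N q x) * p n x)
     (\<lambda>x. (g x * f_N q x) * mehler q t x y 0 0) sequentially"
    unfolding p_def
    by (intro uniform_lim_mult uniform_limit_const uniform_limit_kernel assms compact_imp_bounded
        compact_continuous_image gf compact_S continuous_on_kernel)
  then have ul: "uniform_limit {- 2 / sqrt (1 - q)..2 / sqrt (1 - q)} (\<lambda>n x. (g x * f_N q x) * p n x)
     (\<lambda>x. (g x * f_N q x) * mehler q t x y 0 0) sequentially"
    by (simp only: S_def)
  obtain I J where I: "\<And>n. ((\<lambda>x. (g x * f_N q x) * p n x) has_integral I n) (S q)"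
    and J: "((\<lambda>x. (g x * f_N q x) * mehler q t x y 0 0) has_integral J) (S q)" and IJ: "I \<longlonglongrightarrow> J"
    by (rule uniform_limit_integral[OF ul])
      (use continuous_on_mult[OF gf p] in \<open>auto simp: S_def\<close>)
  have "I n = hermite_int q (\<lambda>x. \<Sum>m<n. (t ^ m / qfact q m * qHermite q m y) * (g x * qHermite q m x))" for n
    unfolding hermite_int_def integral_unique[OF I, symmetric] p_def
    by (simp add: sum_distrib_left sum_distrib_right mult_ac)
  also have "\<dots> n = (\<Sum>m<n. t ^ m / qfact q m * qHermite q m y * hermite_int q (\<lambda>x. g x * qHermite q m x))" for n
    by (intro hermite_int_sum q continuous_on_mult g continuous_on_qHermite) simp
  finally have "I = (\<lambda>n. \<Sum>m<n. t ^ m / qfact q m * qHermite q m y * hermite_int q (\<lambda>x. g x * qHermite q m x))"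
    by blast
  moreover have "J = hermite_int q (\<lambda>x. g x * mehler q t x y 0 0)"
    unfolding hermite_int_def integral_unique[OF J, symmetric] by (simp add: mult_ac)
  ultimately show ?thesis using IJ by (simp add: sums_def)
qed

section \<open>Linearization of products and orthogonality\<close>

definition inv_qfact :: "real \<Rightarrow> nat \<Rightarrow> nat \<Rightarrow> real" where
  "inv_qfact q a k = (if k \<le> a then inverse (qfact q (a - k)) else 0)"

lemma inv_qfact_Suc_Suc: "inv_qfact q (Suc a) (Suc k) = inv_qfact q a k"
  by (simp add: inv_qfact_def)

lemma inv_qfact_Suc_right:
  assumes q: "\<bar>q\<bar> < 1" shows "inv_qfact q a (Suc k) = qnum q (a - k) * inv_qfact q a k"
proof (cases "k < a")
  case True
  then obtain d where "a = Suc (k + d)" using less_imp_Suc_add by blast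
  then have "a - k = Suc d" "a - Suc k = d" "k \<le> a" "Suc k \<le> a" by auto
  then show ?thesis using qfact_neq_0[OF q] qnum_Suc_neq_0[OF q]
    by (simp add: inv_qfact_def qfact_Suc)
qed (auto simp: inv_qfact_def)

text \<open>Equal to \<open>qbinom q a k * qbinom q b k * qfact q k\<close>. The form with
  \<open>inv_qfact\<close> vanishes by itself outside the range of \<open>k\<close> and makes index
  shifts uniform.\<close>

definition lin_coeff :: "real \<Rightarrow> nat \<Rightarrow> nat \<Rightarrow> nat \<Rightarrow> real" where
  "lin_coeff q a b k = qfact q a * qfact q b / qfact q k * inv_qfact q a k * inv_qfact q b k"

lemma lin_coeff_eq_0: "a < k \<or> b < k \<Longrightarrow> lin_coeff q a b k = 0"
  by (auto simp: lin_coeff_def inv_qfact_def)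

lemma lin_coeff_0: "\<bar>q\<bar> < 1 \<Longrightarrow> lin_coeff q a b 0 = 1"
  by (simp add: lin_coeff_def inv_qfact_def qfact_neq_0 field_simps)

text \<open>This compares the coefficients of degree \<open>a + b - 1 - 2 * k\<close> when the
  linearized product is multiplied by \<open>x\<close>. Up to a common factor it is an identity
  between q-integers that follows from \<open>qnum_add\<close>.\<close>

lemma lin_coeff_rec:
  assumes q: "\<bar>q\<bar> < 1"
  shows "lin_coeff q (Suc a) b (Suc k) + qnum q a * lin_coeff q (a - 1) b k
    = lin_coeff q a b (Suc k) + qnum q (a + b - 2 * k) * lin_coeff q a b k"
proof -
  define c where "c = qfact q a * qfact q b / qfact q k"
  define D where "D = inv_qfact q a k * inv_qfact q b k"
  have nz: "qnum q (Suc j) \<noteq> 0" for j using qnum_Suc_neq_0[OF q] .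
  have 1: "lin_coeff q (Suc a) b (Suc k) = c * (qnum q (Suc a) / qnum q (Suc k)) * qnum q (b - k) * D"
    by (simp add: lin_coeff_def inv_qfact_Suc_Suc inv_qfact_Suc_right[OF q] qfact_Suc c_def D_def mult_ac)
  have 2: "qnum q a * lin_coeff q (a - 1) b k = c * qnum q (a - k) * D"
  proof (cases a)
    case (Suc a')
    have "inv_qfact q a' k = qnum q (Suc a' - k) * inv_qfact q (Suc a') k"
      using inv_qfact_Suc_right[OF q, of "Suc a'" k] by (simp add: inv_qfact_Suc_Suc)
    then show ?thesis by (simp add: lin_coeff_def Suc qfact_Suc c_def D_def)
  qed simp
  have 3: "lin_coeff q a b (Suc k) = c / qnum q (Suc k) * qnum q (a - k) * qnum q (b - k) * D"
    by (simp add: lin_coeff_def inv_qfact_Suc_right[OF q] qfact_Suc c_def D_def mult_ac)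
  have 4: "lin_coeff q a b k = c * D" by (simp add: lin_coeff_def c_def D_def)
  show ?thesis
  proof (cases "k \<le> a \<and> k \<le> b")
    case True
    define d e where "d = a - k" "e = b - k"
    have de: "Suc a = d + Suc k" "a + b - 2 * k = d + e" "a - k = d" "b - k = e"
      using True by (auto simp: d_e_def)
    have "qnum q (d + Suc k) * qnum q e + qnum q d * qnum q (Suc k)
      = qnum q d * qnum q e + qnum q (d + e) * qnum q (Suc k)"
      unfolding qnum_add by (simp add: algebra_simps)
    then have "(qnum q (d + Suc k) * qnum q e + qnum q d * qnum q (Suc k)) / qnum q (Suc k)
      = (qnum q d * qnum q e + qnum q (d + e) * qnum q (Suc k)) / qnum q (Suc k)" by simp
    then have "qnum q (d + Suc k) / qnum q (Suc k) * qnum q e + qnum q d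
      = qnum q d * qnum q e / qnum q (Suc k) + qnum q (d + e)"
      using nz[of k] by (simp add: add_divide_distrib)
    then have "c * D * (qnum q (d + Suc k) / qnum q (Suc k) * qnum q e + qnum q d)
      = c * D * (qnum q d * qnum q e / qnum q (Suc k) + qnum q (d + e))" by simp
    then show ?thesis unfolding 1 2 3 4 unfolding de by (simp add: distrib_left mult_ac)
  next
    case False
    then have "D = 0" by (auto simp: D_def inv_qfact_def)
    then show ?thesis unfolding 1 2 3 4 by simp
  qed
qed

text \<open>For fixed \<open>b\<close>, both sides satisfy the three-term recurrence in
  \<open>a\<close> and agree at \<open>a = 0\<close>.\<close>

lemma linearization:
  assumes q: "\<bar>q\<bar> < 1"
  shows "qHermite q a x * qHermite q b x = (\<Sum>k\<le>b. lin_coeff q a b k * qHermite q (a + b - 2 * k) x)"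
proof -
  let ?H = "\<lambda>n. qHermite q n x"
  define F where "F a = (\<Sum>k\<le>b. lin_coeff q a b k * ?H (a + b - 2 * k))" for a
  have rec: "x * F a = F (Suc a) + qnum q a * F (a - 1)" for a
  proof -
    have "x * F a = (\<Sum>k\<le>b. lin_coeff q a b k * (x * ?H (a + b - 2 * k)))"
      by (simp add: F_def sum_distrib_left mult_ac)
    also have "\<dots> = (\<Sum>k\<le>b. lin_coeff q a b k * ?H (Suc (a + b) - 2 * k))
       + (\<Sum>k\<le>b. qnum q (a + b - 2 * k) * lin_coeff q a b k * ?H (a + b - 1 - 2 * k))"
      unfolding sum.distrib[symmetric]
    proof (intro sum.cong refl)
      fix k
      show "lin_coeff q a b k * (x * ?H (a + b - 2 * k)) = lin_coeff q a b k * ?H (Suc (a + b) - 2 * k)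
        + qnum q (a + b - 2 * k) * lin_coeff q a b k * ?H (a + b - 1 - 2 * k)"
      \<comment> \<open>Outside this range truncated subtraction spoils the indices, but the
        coefficient is 0.\<close>
      proof (cases "k \<le> a \<and> k \<le> b")
        case True
        then have "Suc (a + b - 2 * k) = Suc (a + b) - 2 * k" "a + b - 2 * k - 1 = a + b - 1 - 2 * k" by auto
        then show ?thesis unfolding mult_qHermite by (simp add: distrib_left mult_ac del: qHermite.simps)
      qed (simp add: lin_coeff_eq_0 not_le disj_commute)
    qed
    \<comment> \<open>Adding the vanishing term \<open>k = Suc b\<close> and splitting off
      \<open>k = 0\<close> shifts \<open>k\<close> by one, so that this sum has the same degrees as
      the other.\<close>
    also have "(\<Sum>k\<le>b. lin_coeff q a b k * ?H (Suc (a + b) - 2 * k))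
       = ?H (Suc (a + b)) + (\<Sum>k\<le>b. lin_coeff q a b (Suc k) * ?H (a + b - 1 - 2 * k))"
    proof -
      have "(\<Sum>k\<le>b. lin_coeff q a b k * ?H (Suc (a + b) - 2 * k))
        = (\<Sum>k\<le>Suc b. lin_coeff q a b k * ?H (Suc (a + b) - 2 * k))" by (simp add: lin_coeff_eq_0)
      then show ?thesis unfolding sum.atMost_Suc_shift by (simp add: lin_coeff_0[OF q] del: qHermite.simps)
    qed
    finally have 1: "x * F a = ?H (Suc (a + b)) + (\<Sum>k\<le>b. (lin_coeff q a b (Suc k)
        + qnum q (a + b - 2 * k) * lin_coeff q a b k) * ?H (a + b - 1 - 2 * k))"
      by (simp add: distrib_right sum.distrib)
    have "F (Suc a) = (\<Sum>k\<le>Suc b. lin_coeff q (Suc a) b k * ?H (Suc (a + b) - 2 * k))"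
      by (simp add: F_def lin_coeff_eq_0)
    also have "\<dots> = ?H (Suc (a + b)) + (\<Sum>k\<le>b. lin_coeff q (Suc a) b (Suc k) * ?H (a + b - 1 - 2 * k))"
      unfolding sum.atMost_Suc_shift by (simp add: lin_coeff_0[OF q] del: qHermite.simps)
    finally have 2: "F (Suc a) = \<dots>" .
    have 3: "qnum q a * F (a - 1) = (\<Sum>k\<le>b. qnum q a * lin_coeff q (a - 1) b k * ?H (a + b - 1 - 2 * k))"
      by (cases a) (simp_all add: F_def sum_distrib_left mult_ac)
    show ?thesis unfolding 1 2 3 lin_coeff_rec[OF q, symmetric] by (simp add: distrib_right sum.distrib)
  qed
  have F0: "F 0 = ?H b"
  proof -
    have "F 0 = (\<Sum>k\<le>b. if k = 0 then ?H b else 0)"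
      unfolding F_def by (intro sum.cong refl) (auto simp: lin_coeff_0[OF q] lin_coeff_eq_0)
    then show ?thesis by (simp add: sum.delta)
  qed
  have "?H a * ?H b = F a"
  proof (induction a rule: less_induct)
    case (less a)
    show ?case
    proof (cases a)
      case 0
      then show ?thesis by (simp add: F0)
    next
      case (Suc m)
      have "?H a * ?H b = x * (?H m * ?H b) - qnum q m * (?H (m - 1) * ?H b)"
        unfolding Suc mult.assoc[symmetric] mult_qHermite[of x q m] by (simp only: distrib_right)
      also have "?H m * ?H b = F m" using less Suc by simp
      also have "qnum q m * (?H (m - 1) * ?H b) = qnum q m * F (m - 1)"
        using less[of "m - 1"] Suc by (cases m) auto
      finally show ?thesis using rec[of m] Suc by simp
    qed
  qed
  then show ?thesis by (simp add: F_def)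
qed

text \<open>In the linearized product only degree 0 survives integration, which forces
  \<open>k = m = n\<close>.\<close>

lemma hermite_int_qHermite_orth:
  assumes q: "\<bar>q\<bar> < 1"
  shows "hermite_int q (\<lambda>x. qHermite q n x * qHermite q m x) = (if m = n then qfact q n else 0)"
proof -
  have "hermite_int q (\<lambda>x. qHermite q n x * qHermite q m x)
    = (\<Sum>k\<le>m. lin_coeff q n m k * hermite_int q (qHermite q (n + m - 2 * k)))"
    unfolding linearization[OF q] by (intro hermite_int_sum q continuous_on_qHermite) simp
  also have "\<dots> = (\<Sum>k\<le>m. if k = m then (if m = n then qfact q n else 0) else 0)"
  proof (intro sum.cong refl)
    fix k assume "k \<in> {..m}"
    then consider "n < k" | "k \<le> n" "k = m" "m = n" | "k \<le> n" "k < m \<or> m < n" by fastforce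
    then show "lin_coeff q n m k * hermite_int q (qHermite q (n + m - 2 * k))
      = (if k = m then (if m = n then qfact q n else 0) else 0)"
    proof cases
      case 2
      then show ?thesis using qfact_neq_0[OF q] by (simp add: hermite_int_qHermite[OF q] lin_coeff_def inv_qfact_def)
    next
      case 3
      then have "n + m - 2 * k \<noteq> 0" using \<open>k \<in> {..m}\<close> by auto
      then show ?thesis using 3 by (auto simp add: hermite_int_qHermite[OF q])
    qed (auto simp: lin_coeff_eq_0)
  qed
  also have "\<dots> = (if m = n then qfact q n else 0)" by (subst sum.delta) auto
  finally show ?thesis .
qed

section \<open>Integrals against one and two kernels\<close>

lemma hermite_int_qHermite_kernel:
  assumes q: "\<bar>q\<bar> < 1" and t: "\<bar>t\<bar> < 1" and y: "y \<in> S q"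
  shows "hermite_int q (\<lambda>x. qHermite q n x * mehler q t x y 0 0) = t ^ n * qHermite q n y"
proof -
  have "(\<lambda>m. t ^ m / qfact q m * qHermite q m y * hermite_int q (\<lambda>x. qHermite q n x * qHermite q m x))
     = (\<lambda>m. if m = n then t ^ n * qHermite q n y else 0)"
    using qfact_neq_0[OF q] by (auto simp: hermite_int_qHermite_orth[OF q])
  then have "(\<lambda>m. if m = n then t ^ n * qHermite q n y else 0) sums
     hermite_int q (\<lambda>x. qHermite q n x * mehler q t x y 0 0)"
    using hermite_int_kernel_sums[OF q t y continuous_on_qHermite[of _ q n]] by simp
  then show ?thesis using sums_single[of n "\<lambda>_. t ^ n * qHermite q n y"] sums_unique2 by blast
qed

text \<open>The kernel in \<open>y\<close> is expanded, each product with
  \<open>qHermite q n\<close> is linearized, and the kernel in \<open>z\<close> reproduces every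
  resulting polynomial. What remains for fixed \<open>k\<close> is a kernel shifted by
  \<open>k\<close> and \<open>n - k\<close>.\<close>

lemma hermite_int_two_kernels:
  assumes q: "\<bar>q\<bar> < 1" and r: "\<bar>r\<bar> < 1" and s: "\<bar>s\<bar> < 1" and yz: "y \<in> S q" "z \<in> S q"
  shows "hermite_int q (\<lambda>x. qHermite q n x * mehler q s x z 0 0 * mehler q r x y 0 0)
    = qfact q n * kernel_poly (\<lambda>i j. mehler q (r * s) y z i j / (qfact q i * qfact q j)) n r s"
proof -
  let ?H = "qHermite q"
  have rs: "\<bar>r * s\<bar> < 1"
    using mult_strict_mono'[of "\<bar>r\<bar>" 1 "\<bar>s\<bar>" 1] r s by (simp add: abs_mult)
  have E: "hermite_int q (\<lambda>x. ?H n x * mehler q s x z 0 0 * ?H b x)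
    = (\<Sum>k\<le>n. lin_coeff q b n k * (s ^ (b + n - 2 * k) * ?H (b + n - 2 * k) z))" for b
  proof -
    have "hermite_int q (\<lambda>x. ?H n x * mehler q s x z 0 0 * ?H b x)
      = hermite_int q (\<lambda>x. \<Sum>k\<le>n. lin_coeff q b n k * (?H (b + n - 2 * k) x * mehler q s x z 0 0))"
    proof (intro arg_cong[where f = "hermite_int q"] ext)
      fix x
      have "?H n x * mehler q s x z 0 0 * ?H b x = (?H b x * ?H n x) * mehler q s x z 0 0" by simp
      also have "\<dots> = (\<Sum>k\<le>n. lin_coeff q b n k * (?H (b + n - 2 * k) x * mehler q s x z 0 0))"
        by (simp only: linearization[OF q] sum_distrib_right mult.assoc)
      finally show "?H n x * mehler q s x z 0 0 * ?H b x
        = (\<Sum>k\<le>n. lin_coeff q b n k * (?H (b + n - 2 * k) x * mehler q s x z 0 0))" .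
    qed
    also have "\<dots> = (\<Sum>k\<le>n. lin_coeff q b n k * hermite_int q (\<lambda>x. ?H (b + n - 2 * k) x * mehler q s x z 0 0))"
      by (intro hermite_int_sum q continuous_on_mult continuous_on_qHermite continuous_on_kernel s yz) simp
    finally show ?thesis unfolding hermite_int_qHermite_kernel[OF q s yz(2)] .
  qed
  have "(\<lambda>b. \<Sum>k\<le>n. r ^ b / qfact q b * ?H b y * (lin_coeff q b n k * (s ^ (b + n - 2 * k) * ?H (b + n - 2 * k) z)))
     sums hermite_int q (\<lambda>x. ?H n x * mehler q s x z 0 0 * mehler q r x y 0 0)"
    unfolding sum_distrib_left[symmetric] E[symmetric]
    by (intro hermite_int_kernel_sums q r yz continuous_on_mult continuous_on_qHermite continuous_on_kernel s)
  moreover have "(\<lambda>b. \<Sum>k\<le>n. r ^ b / qfact q b * ?H b y * (lin_coeff q b n k * (s ^ (b + n - 2 * k) * ?H (b + n - 2 * k) z)))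
     sums (\<Sum>k\<le>n. qfact q n * (r ^ k * s ^ (n - k) * (mehler q (r * s) y z k (n - k) / (qfact q k * qfact q (n - k)))))"
  proof (intro sums_sum)
    fix k assume k: "k \<in> {..n}"
    let ?f = "\<lambda>b. r ^ b / qfact q b * ?H b y * (lin_coeff q b n k * (s ^ (b + n - 2 * k) * ?H (b + n - 2 * k) z))"
    let ?c = "qfact q n * (r ^ k * s ^ (n - k)) / (qfact q k * qfact q (n - k))"
    \<comment> \<open>The substitution \<open>b = m + k\<close> loses nothing because
      \<open>lin_coeff q b n k\<close> is 0 for \<open>b < k\<close>. The factor
      \<open>qfact q b\<close> in that coefficient cancels the one in the expansion, leaving
      \<open>qfact q m\<close>.\<close>
    have f: "?f (m + k) = ?c * ((r * s) ^ m / qfact q m * ?H (m + k) y * ?H (m + (n - k)) z)" for m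
    proof -
      have e: "m + k + n - 2 * k = m + (n - k)" using k by auto
      have "lin_coeff q (m + k) n k = qfact q (m + k) * (qfact q n / (qfact q k * qfact q m * qfact q (n - k)))"
        using k by (simp add: lin_coeff_def inv_qfact_def divide_inverse)
      then show ?thesis unfolding e using qfact_neq_0[OF q]
        by (simp add: power_add power_mult_distrib mult_ac)
    qed
    have "(\<lambda>m. ?f (m + k)) sums (?c * mehler q (r * s) y z k (n - k))"
      unfolding f mehler_def by (intro sums_mult summable_sums summable_mehler q rs yz)
    then have "?f sums (?c * mehler q (r * s) y z k (n - k))"
      by (subst (asm) sums_zero_iff_shift) (simp_all add: lin_coeff_eq_0)
    then show "?f sums (qfact q n * (r ^ k * s ^ (n - k) * (mehler q (r * s) y z k (n - k) / (qfact q k * qfact q (n - k)))))"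
      by (simp add: mult.assoc)
  qed
  ultimately show ?thesis unfolding kernel_poly_def sum_distrib_left by (rule sums_unique2)
qed

lemma mehler_neq_0:
  assumes q: "\<bar>q\<bar> < 1" and t: "\<bar>t\<bar> < 1" and yz: "y \<in> S q" "z \<in> S q"
  shows "mehler q t y z 0 0 \<noteq> 0"
proof -
  have "\<bar>t\<^sup>2\<bar> < 1" using t by (simp add: abs_square_less_1)
  then have "qpoch_inf (t\<^sup>2) q \<noteq> 0" using qpoch_inf_pos[OF q] by (metis less_irrefl)
  moreover have "(\<Prod>k. w k y z t q) \<noteq> 0"
  proof (rule prodinf_nonzero[OF convergent_prod_w[OF q]])
    show "w k y z t q \<noteq> 0" for k using w_pos[OF q t yz, of k] by simp
  qed
  ultimately show ?thesis by (simp add: Poisson_Mehler[OF assms])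
qed

lemma phi_eq:
  assumes q: "\<bar>q\<bar> < 1" and r: "\<bar>r\<bar> < 1" and s: "\<bar>s\<bar> < 1" and xyz: "x \<in> S q" "y \<in> S q" "z \<in> S q"
  shows "phi x y r z s q = mehler q s x z 0 0 * mehler q r x y 0 0 * f_N q x / mehler q (r * s) y z 0 0"
proof -
  have rs: "\<bar>r * s\<bar> < 1"
    using mult_strict_mono'[of "\<bar>r\<bar>" 1 "\<bar>s\<bar>" 1] r s by (simp add: abs_mult)
  have "(\<Prod>k. w k y z (r * s) q / (w k x y r q * w k x z s q))
    = (\<Prod>k. w k y z (r * s) q) / (\<Prod>k. w k x y r q * w k x z s q)"
    by (intro prodinf_divide[symmetric] convergent_prod_mult convergent_prod_w q)
  also have "(\<Prod>k. w k x y r q * w k x z s q) = (\<Prod>k. w k x y r q) * (\<Prod>k. w k x z s q)"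
    by (intro prodinf_mult[symmetric] convergent_prod_w q)
  finally show ?thesis
    unfolding phi_def Poisson_Mehler[OF q r xyz(1,2)] Poisson_Mehler[OF q s xyz(1,3)]
      Poisson_Mehler[OF q rs xyz(2,3)] by (simp add: power_mult_distrib mult_ac)
qed

lemma tpoch_eq_qpoch: "tpoch q (r * s) m r s = r ^ m * qpoch (s\<^sup>2) q m"
  by (induction m) (simp_all add: tpoch_Suc qpoch_Suc power2_eq_square algebra_simps)

lemma qpoch_add: "qpoch a q (m + n) = qpoch a q m * qpoch (a * q ^ m) q n"
  by (induction n) (simp_all add: qpoch_Suc power_add mult_ac)

text \<open>At \<open>t = r * s\<close> the products \<open>tpoch\<close> become genuine
  q-Pochhammer symbols, and \<open>qpoch_add\<close> splits off their first \<open>k\<close>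
  factors. The summation index \<open>i\<close> corresponds to \<open>n - k - j\<close>.\<close>

lemma moment_poly_explicit:
  assumes q: "\<bar>q\<bar> < 1"
  shows "qfact q n * moment_poly q (r * s) y z n r s =
      (\<Sum>k = 0..n div 2.
         (-1) ^ k * q ^ (k choose 2) * qbinom q n (2 * k) * qbinom q (2 * k) k * qfact q k *
         r ^ (2 * k) * s ^ (2 * k) * qpoch (r\<^sup>2) q k * qpoch (s\<^sup>2) q k *
         (\<Sum>j = 0..n - 2 * k.
            qbinom q (n - 2 * k) j *
            qpoch (r\<^sup>2 * q ^ k) q j * qpoch (s\<^sup>2 * q ^ k) q (n - 2 * k - j) *
            r ^ (n - 2 * k - j) * s ^ j *
            qHermite q j z * qHermite q (n - 2 * k - j) y))"
proof -
  let ?H = "qHermite q"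
  define T where "T k i = qfact q n * (tpoch q (r * s) i r s * tpoch q (r * s) (n - i) s r *
    (mcoeff q (r * s) k * shifted_hat q y i k * shifted_hat q z (n - i) k))" for k i
  have nz: "qfact q m \<noteq> 0" for m using qfact_neq_0[OF q] .
  have "qfact q n * moment_poly q (r * s) y z n r s = (\<Sum>i\<le>n. \<Sum>k\<le>n. T k i)"
    by (simp add: moment_poly_def T_def mehler_poly_extend[where K = n] sum_distrib_left)
  also have "\<dots> = (\<Sum>k\<le>n. \<Sum>i\<le>n. T k i)" by (rule sum.swap)
  \<comment> \<open>A nonzero term requires both \<open>k \<le> i\<close> and
    \<open>k \<le> n - i\<close>, hence \<open>2 * k \<le> n\<close>.\<close>
  also have "\<dots> = (\<Sum>k = 0..n div 2. \<Sum>i\<le>n. T k i)"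
    by (intro sum.mono_neutral_right) (auto simp: T_def shifted_hat_def intro!: sum.neutral)
  also have "\<dots> = (\<Sum>k = 0..n div 2. \<Sum>j = 0..n - 2 * k. T k (n - k - j))"
  proof (rule sum.cong[OF refl])
    fix k assume k: "k \<in> {0..n div 2}"
    have "(\<Sum>i\<le>n. T k i) = (\<Sum>i = k..n - k. T k i)"
      by (intro sum.mono_neutral_right) (auto simp: T_def shifted_hat_def)
    also have "\<dots> = (\<Sum>j = 0..n - 2 * k. T k (n - k - j))"
      by (rule sum.reindex_bij_witness[of _ "\<lambda>j. n - k - j" "\<lambda>i. n - k - i"]) (use k in auto)
    finally show "(\<Sum>i\<le>n. T k i) = (\<Sum>j = 0..n - 2 * k. T k (n - k - j))" .
  qed
  also have "\<dots> = (\<Sum>k = 0..n div 2. \<Sum>j = 0..n - 2 * k.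
         (-1) ^ k * q ^ (k choose 2) * qbinom q n (2 * k) * qbinom q (2 * k) k * qfact q k *
         r ^ (2 * k) * s ^ (2 * k) * qpoch (r\<^sup>2) q k * qpoch (s\<^sup>2) q k *
           (qbinom q (n - 2 * k) j *
            qpoch (r\<^sup>2 * q ^ k) q j * qpoch (s\<^sup>2 * q ^ k) q (n - 2 * k - j) *
            r ^ (n - 2 * k - j) * s ^ j * ?H j z * ?H (n - 2 * k - j) y))"
  proof (intro sum.cong refl)
    fix k j assume "k \<in> {0..n div 2}" "j \<in> {0..n - 2 * k}"
    then have "n = (n - 2 * k - j) + j + 2 * k" by auto
    then obtain i where n: "n = i + j + 2 * k" by blast
    have e: "n - k - j = i + k" "n - (i + k) = j + k" "n - 2 * k - j = i" "n - 2 * k = i + j" "2 * k - k = k"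
      "2 * k \<le> n" "n - (k + k) = i + j"
      by (auto simp: n)
    have A: "tpoch q (r * s) (i + k) r s = r ^ i * r ^ k * (qpoch (s\<^sup>2) q k * qpoch (s\<^sup>2 * q ^ k) q i)"
      using qpoch_add[of "s\<^sup>2" q k i] by (simp add: tpoch_eq_qpoch power_add add.commute)
    have B: "tpoch q (r * s) (j + k) s r = s ^ j * s ^ k * (qpoch (r\<^sup>2) q k * qpoch (r\<^sup>2 * q ^ k) q j)"
      using qpoch_add[of "r\<^sup>2" q k j] tpoch_eq_qpoch[of q s r "j + k"]
      by (simp add: power_add add.commute mult.commute[of s r])
    show "T k (n - k - j) =
         (-1) ^ k * q ^ (k choose 2) * qbinom q n (2 * k) * qbinom q (2 * k) k * qfact q k *
         r ^ (2 * k) * s ^ (2 * k) * qpoch (r\<^sup>2) q k * qpoch (s\<^sup>2) q k *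
           (qbinom q (n - 2 * k) j *
            qpoch (r\<^sup>2 * q ^ k) q j * qpoch (s\<^sup>2 * q ^ k) q (n - 2 * k - j) *
            r ^ (n - 2 * k - j) * s ^ j * ?H j z * ?H (n - 2 * k - j) y)"
      unfolding T_def e A B using e(6) nz
      by (simp add: qbinom_def e shifted_hat_def mcoeff_def power_mult_distrib mult_2 power_add) (simp add: mult_ac)
  qed
  finally show ?thesis by (simp only: sum_distrib_left)
qed

theorem theorem2:
  fixes q \<rho>1 \<rho>2 y z :: real and n :: nat
  assumes "\<bar>q\<bar> < 1" and "\<bar>\<rho>1\<bar> < 1" and "\<bar>\<rho>2\<bar> < 1"
    and "y \<in> S q" and "z \<in> S q" and "n \<ge> 1"
  shows "set_integrable lborel (S q) (\<lambda>x. qHermite q n x * phi x y \<rho>1 z \<rho>2 q) \<and>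
    C n y z \<rho>1 \<rho>2 q =
      1 / qpoch (\<rho>1\<^sup>2 * \<rho>2\<^sup>2) q n *
      (\<Sum>k = 0..n div 2.
         (-1) ^ k * q ^ (k choose 2) * qbinom q n (2 * k) * qbinom q (2 * k) k * qfact q k *
         \<rho>1 ^ (2 * k) * \<rho>2 ^ (2 * k) * qpoch (\<rho>1\<^sup>2) q k * qpoch (\<rho>2\<^sup>2) q k *
         (\<Sum>j = 0..n - 2 * k.
            qbinom q (n - 2 * k) j *
            qpoch (\<rho>1\<^sup>2 * q ^ k) q j * qpoch (\<rho>2\<^sup>2 * q ^ k) q (n - 2 * k - j) *
            \<rho>1 ^ (n - 2 * k - j) * \<rho>2 ^ j *
            qHermite q j z * qHermite q (n - 2 * k - j) y))"
proof -
  note q = assms(1) and r = assms(2) and s = assms(3) and yz = assms(4,5)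
  define t where "t = \<rho>1 * \<rho>2"
  have t: "\<bar>t\<bar> < 1"
    using mult_strict_mono'[of "\<bar>\<rho>1\<bar>" 1 "\<bar>\<rho>2\<bar>" 1] r s by (simp add: t_def abs_mult)
  then have t2: "\<bar>t\<^sup>2\<bar> < 1" by (simp add: abs_square_less_1)
  let ?G = "mehler q t y z 0 0"
  let ?g = "\<lambda>x. qHermite q n x * mehler q \<rho>2 x z 0 0 * mehler q \<rho>1 x y 0 0"
  have eq: "qHermite q n x * phi x y \<rho>1 z \<rho>2 q = ?g x * f_N q x / ?G" if "x \<in> S q" for x
    by (simp add: phi_eq[OF q r s that yz] t_def)
  have g: "continuous_on (S q) ?g"
    by (intro continuous_on_mult continuous_on_qHermite continuous_on_kernel q r s yz)
  have "continuous_on (S q) (\<lambda>x. ?g x * f_N q x / ?G)"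
    by (intro continuous_on_divide continuous_on_mult[OF g] continuous_on_f_N q continuous_on_const)
      (simp add: mehler_neq_0[OF q t yz])
  then have "continuous_on (S q) (\<lambda>x. qHermite q n x * phi x y \<rho>1 z \<rho>2 q)"
    by (subst continuous_on_cong[OF refl eq])
  \<comment> \<open>Integrability also identifies the Lebesgue integral in \<open>C\<close> with the
    gauge integral in which the moments were computed.\<close>
  then have int: "set_integrable lborel (S q) (\<lambda>x. qHermite q n x * phi x y \<rho>1 z \<rho>2 q)"
    unfolding S_def by (rule borel_integrable_atLeastAtMost')
  have "C n y z \<rho>1 \<rho>2 q = integral (S q) (\<lambda>x. qHermite q n x * phi x y \<rho>1 z \<rho>2 q)"
    unfolding C_def by (rule set_borel_integral_eq_integral(2)[OF int])
  also have "\<dots> = hermite_int q ?g / ?G"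
  proof (rule integral_unique)
    have "((\<lambda>x. ?g x * f_N q x / ?G) has_integral hermite_int q ?g / ?G) (S q)"
      by (intro has_integral_divide hermite_int_has_integral q g)
    then show "((\<lambda>x. qHermite q n x * phi x y \<rho>1 z \<rho>2 q) has_integral hermite_int q ?g / ?G) (S q)"
      by (rule has_integral_eq[rotated]) (simp add: eq)
  qed
  also have "hermite_int q ?g = qfact q n * kernel_poly (\<lambda>i j. mehler q t y z i j / (qfact q i * qfact q j)) n \<rho>1 \<rho>2"
    unfolding t_def by (rule hermite_int_two_kernels[OF q r s yz])
  also have "\<dots> / ?G = qfact q n * moment_poly q t y z n \<rho>1 \<rho>2 / qpoch (t\<^sup>2) q n"
  proof -
    have "qpoch (t\<^sup>2) q n * kernel_poly (\<lambda>i j. mehler q t y z i j / (qfact q i * qfact q j)) n \<rho>1 \<rho>2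
      = ?G * moment_poly q t y z n \<rho>1 \<rho>2"
      using kernel_poly_eq_moment_poly[OF q hat_mehler_rec[OF q t yz], of n \<rho>1 \<rho>2] by simp
    moreover have "qpoch (t\<^sup>2) q n \<noteq> 0" using qpoch_pos[OF q t2, of n] by simp
    ultimately show ?thesis using mehler_neq_0[OF q t yz] by (simp add: field_simps)
  qed
  finally have "C n y z \<rho>1 \<rho>2 q = 1 / qpoch (\<rho>1\<^sup>2 * \<rho>2\<^sup>2) q n * (qfact q n * moment_poly q (\<rho>1 * \<rho>2) y z n \<rho>1 \<rho>2)"
    by (simp add: t_def power_mult_distrib)
  then show ?thesis unfolding moment_poly_explicit[OF q] using int by blast
qed

end
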